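(* Let $R$ be the hyperfinite ${\rm II}_1$ factor, let $\theta\in(0,1)$ be irrational, and let $u,v\in R$ be unitary operators with $R=\{u,v\}''$ and $vu=e^{2\pi i\theta}uv$. Let $\gamma\in C(S^1)$ be a non-negative function. If the generalized universal irrational rotation $C^*$-algebra $A_{\theta,\gamma}=C^*(u\gamma^{1/2}(v),v)$ is simple, then $A_{\theta,\gamma}$ is generated, as a $C^*$-algebra, by an element $uf(v)$ and the identity operator for some $f\in C(S^1)$.
   Context: $S^1$ is the unit circle in $\mathbb{C}$; $f(v)$ is defined by functional calculus. For an irrational number $\theta$ and a non-negative function $\gamma\in C(S^1)$, the generalized universal irrational rotation $C^*$-algebra $A_{\theta,\gamma}$ is the universal $C^*$-algebra generated by elements $x$ and $w$ satisfying $w^*w=ww^*=1$, $x^*x=\gamma(w)$, $xx^*=\gamma(e^{-2\pi i\theta}w)$, and $xw=e^{-2\pi i\theta}wx$. It is identified with the $C^*$-subalgebra $C^*(u\gamma^{1/2}(v),v)$ of $R$ generated by $u\gamma^{1/2}(v)$ and $v$, via $x\mapsto u\gamma^{1/2}(v)$, $w\mapsto v$. *)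

theory Defs
  imports "HOL-Analysis.Analysis"
begin

section \<open>Complex Hilbert spaces\<close>

text \<open>The inner product is linear in the first and conjugate-linear in the second argument.
  Completeness is part of the class \<open>banach\<close>.\<close>

class complex_hilbert_space = banach +
  fixes scaleC :: "complex \<Rightarrow> 'a \<Rightarrow> 'a"  (infixr "*\<^sub>C" 75)
    and cinner :: "'a \<Rightarrow> 'a \<Rightarrow> complex"
  assumes scaleC_add_right: "c *\<^sub>C (x + y) = c *\<^sub>C x + c *\<^sub>C y"
    and scaleC_add_left: "(c + d) *\<^sub>C x = c *\<^sub>C x + d *\<^sub>C x"
    and scaleC_scaleC: "c *\<^sub>C (d *\<^sub>C x) = (c * d) *\<^sub>C x"
    and scaleC_of_real: "complex_of_real r *\<^sub>C x = r *\<^sub>R x"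
    and cinner_commute: "cinner x y = cnj (cinner y x)"
    and cinner_add_left: "cinner (x + y) z = cinner x z + cinner y z"
    and cinner_scaleC_left: "cinner (c *\<^sub>C x) y = c * cinner x y"
    and cinner_self: "cinner x x = complex_of_real ((norm x)\<^sup>2)"

instantiation complex :: complex_hilbert_space
begin

definition scaleC_complex :: "complex \<Rightarrow> complex \<Rightarrow> complex"
  where "scaleC_complex c x = c * x"

definition cinner_complex :: "complex \<Rightarrow> complex \<Rightarrow> complex"
  where "cinner_complex x y = x * cnj y"

instance
  by standard
    (simp_all add: scaleC_complex_def cinner_complex_def algebra_simps scaleR_conv_of_real
       complex_mult_cnj cmod_power2)

end

lemma norm_scaleC: "norm (c *\<^sub>C x) = cmod c * norm (x :: 'a::complex_hilbert_space)"
proof -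
  have "cinner (c *\<^sub>C x) (c *\<^sub>C x) = c * cnj c * cinner x x"
    by (metis cinner_commute cinner_scaleC_left complex_cnj_mult mult.assoc mult.left_commute)
  also have "\<dots> = complex_of_real ((cmod c * norm x)\<^sup>2)"
    by (simp add: cinner_self complex_mult_cnj cmod_power2 power_mult_distrib)
  finally have "(norm (c *\<^sub>C x))\<^sup>2 = (cmod c * norm x)\<^sup>2"
    unfolding cinner_self by (simp only: of_real_eq_iff)
  then show ?thesis
    by (simp add: power2_eq_iff_nonneg)
qed

lemma bounded_linear_scaleC: "bounded_linear (\<lambda>x :: 'a::complex_hilbert_space. c *\<^sub>C x)"
proof (rule bounded_linear_intro)
  fix r and x y :: 'a
  show "c *\<^sub>C (x + y) = c *\<^sub>C x + c *\<^sub>C y"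
    by (rule scaleC_add_right)
  show "c *\<^sub>C (r *\<^sub>R x) = r *\<^sub>R (c *\<^sub>C x)"
    by (metis mult.commute scaleC_of_real scaleC_scaleC)
  show "norm (c *\<^sub>C x) \<le> norm x * cmod c"
    by (simp add: norm_scaleC mult.commute)
qed


section \<open>Bounded operators\<close>

text \<open>The library type \<open>'a \<Rightarrow>\<^sub>L 'a\<close> consists of the bounded real-linear maps;
  \<open>bounded_ops\<close> is the algebra of bounded complex-linear operators inside it.\<close>

definition bounded_ops :: "('a::complex_hilbert_space \<Rightarrow>\<^sub>L 'a) set"
  where "bounded_ops = {T. \<forall>c x. blinfun_apply T (c *\<^sub>C x) = c *\<^sub>C blinfun_apply T x}"

text \<open>The operator \<open>c \<cdot> 1\<close>; the scalar multiple \<open>c \<cdot> T\<close> is written \<open>scalar_op c o\<^sub>L T\<close>.\<close>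

definition scalar_op :: "complex \<Rightarrow> ('a::complex_hilbert_space \<Rightarrow>\<^sub>L 'a)"
  where "scalar_op c = Blinfun (\<lambda>x. c *\<^sub>C x)"

lemma scalar_op_apply: "blinfun_apply (scalar_op c) x = c *\<^sub>C x"
  unfolding scalar_op_def by (simp add: bounded_linear_Blinfun_apply bounded_linear_scaleC)

text \<open>On \<open>bounded_ops\<close> the adjoint exists and is unique by the Riesz representation theorem.\<close>

definition adj :: "('a::complex_hilbert_space \<Rightarrow>\<^sub>L 'a) \<Rightarrow> ('a \<Rightarrow>\<^sub>L 'a)"
  where "adj T = (THE S. \<forall>x y. cinner (blinfun_apply T x) y = cinner x (blinfun_apply S y))"

definition unitary_op :: "('a::complex_hilbert_space \<Rightarrow>\<^sub>L 'a) \<Rightarrow> bool"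
  where "unitary_op u \<longleftrightarrow>
    u \<in> bounded_ops \<and> adj u o\<^sub>L u = id_blinfun \<and> u o\<^sub>L adj u = id_blinfun"

definition star_subalgebra :: "('a::complex_hilbert_space \<Rightarrow>\<^sub>L 'a) set \<Rightarrow> bool"
  where "star_subalgebra A \<longleftrightarrow> A \<subseteq> bounded_ops \<and> 0 \<in> A \<and>
    (\<forall>a\<in>A. \<forall>b\<in>A. a + b \<in> A) \<and>
    (\<forall>c. \<forall>a\<in>A. scalar_op c o\<^sub>L a \<in> A) \<and>
    (\<forall>a\<in>A. \<forall>b\<in>A. a o\<^sub>L b \<in> A) \<and>
    (\<forall>a\<in>A. adj a \<in> A)"


section \<open>The hyperfinite II\<open>\<^sub>1\<close> factor\<close>

definition commutant :: "('a::complex_hilbert_space \<Rightarrow>\<^sub>L 'a) set \<Rightarrow> ('a \<Rightarrow>\<^sub>L 'a) set"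
  where "commutant S = {T \<in> bounded_ops. \<forall>A\<in>S. T o\<^sub>L A = A o\<^sub>L T}"

definition von_neumann_algebra :: "('a::complex_hilbert_space \<Rightarrow>\<^sub>L 'a) set \<Rightarrow> bool"
  where "von_neumann_algebra R \<longleftrightarrow> star_subalgebra R \<and> commutant (commutant R) = R"

definition factor :: "('a::complex_hilbert_space \<Rightarrow>\<^sub>L 'a) set \<Rightarrow> bool"
  where "factor R \<longleftrightarrow> von_neumann_algebra R \<and>
    (id_blinfun :: 'a \<Rightarrow>\<^sub>L 'a) \<noteq> 0 \<and> R \<inter> commutant R = range scalar_op"

definition projections :: "('a::complex_hilbert_space \<Rightarrow>\<^sub>L 'a) set \<Rightarrow> ('a \<Rightarrow>\<^sub>L 'a) set"
  where "projections R = {p \<in> R. p o\<^sub>L p = p \<and> adj p = p}"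

definition mvn_equiv ::
  "('a::complex_hilbert_space \<Rightarrow>\<^sub>L 'a) set \<Rightarrow> ('a \<Rightarrow>\<^sub>L 'a) \<Rightarrow> ('a \<Rightarrow>\<^sub>L 'a) \<Rightarrow> bool"
  where "mvn_equiv R p q \<longleftrightarrow> (\<exists>w\<in>R. adj w o\<^sub>L w = p \<and> w o\<^sub>L adj w = q)"

text \<open>The condition \<open>p o\<^sub>L q = q\<close> says that \<open>q\<close> is a subprojection of \<open>p\<close>.\<close>

definition finite_projection ::
  "('a::complex_hilbert_space \<Rightarrow>\<^sub>L 'a) set \<Rightarrow> ('a \<Rightarrow>\<^sub>L 'a) \<Rightarrow> bool"
  where "finite_projection R p \<longleftrightarrow> p \<in> projections R \<and>
    (\<forall>q\<in>projections R. p o\<^sub>L q = q \<and> mvn_equiv R p q \<longrightarrow> q = p)"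

definition abelian_projection ::
  "('a::complex_hilbert_space \<Rightarrow>\<^sub>L 'a) set \<Rightarrow> ('a \<Rightarrow>\<^sub>L 'a) \<Rightarrow> bool"
  where "abelian_projection R p \<longleftrightarrow> p \<in> projections R \<and>
    (\<forall>a\<in>R. \<forall>b\<in>R. (p o\<^sub>L a o\<^sub>L p) o\<^sub>L (p o\<^sub>L b o\<^sub>L p) = (p o\<^sub>L b o\<^sub>L p) o\<^sub>L (p o\<^sub>L a o\<^sub>L p))"

definition II1_factor :: "('a::complex_hilbert_space \<Rightarrow>\<^sub>L 'a) set \<Rightarrow> bool"
  where "II1_factor R \<longleftrightarrow> factor R \<and> finite_projection R id_blinfun \<and>
    (\<forall>p. abelian_projection R p \<longrightarrow> p = 0)"

text \<open>The \<open>span\<close> is the real one; for a complex subspace, finite real dimension and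
  finite complex dimension are the same.  The bicommutant of the union is its closure in the
  weak operator topology.\<close>

definition hyperfinite :: "('a::complex_hilbert_space \<Rightarrow>\<^sub>L 'a) set \<Rightarrow> bool"
  where "hyperfinite R \<longleftrightarrow> (\<exists>A :: nat \<Rightarrow> ('a \<Rightarrow>\<^sub>L 'a) set.
    incseq A \<and>
    (\<forall>n. star_subalgebra (A n) \<and> id_blinfun \<in> A n \<and> (\<exists>B. finite B \<and> A n = span B)) \<and>
    R = commutant (commutant (\<Union>n. A n)))"


section \<open>Functional calculus of a unitary operator\<close>

text \<open>\<open>C(S\<^sup>1)\<close> is rendered by functions on \<open>\<complex>\<close> that are continuous on the circle; values
  off the circle are irrelevant by the second condition below.  Compatibility with complex
  scalars is contained in the conditions on products and on constant functions.\<close>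

definition circle_star_hom ::
  "((complex \<Rightarrow> complex) \<Rightarrow> ('a::complex_hilbert_space \<Rightarrow>\<^sub>L 'a)) \<Rightarrow> bool"
  where "circle_star_hom \<Phi> \<longleftrightarrow> (let C = {f. continuous_on (sphere 0 1) f} in
    (\<forall>f\<in>C. \<Phi> f \<in> bounded_ops) \<and>
    (\<forall>f\<in>C. \<forall>g\<in>C. (\<forall>z\<in>sphere 0 1. f z = g z) \<longrightarrow> \<Phi> f = \<Phi> g) \<and>
    (\<forall>f\<in>C. \<forall>g\<in>C. \<Phi> (\<lambda>z. f z + g z) = \<Phi> f + \<Phi> g) \<and>
    (\<forall>f\<in>C. \<forall>g\<in>C. \<Phi> (\<lambda>z. f z * g z) = \<Phi> f o\<^sub>L \<Phi> g) \<and>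
    (\<forall>c. \<Phi> (\<lambda>z. c) = scalar_op c) \<and>
    (\<forall>f\<in>C. \<Phi> (\<lambda>z. cnj (f z)) = adj (\<Phi> f)))"

text \<open>For unitary \<open>v\<close> there is exactly one unital \<open>*\<close>-homomorphism from \<open>C(S\<^sup>1)\<close> to the bounded
  operators that maps the identity function to \<open>v\<close>, and \<open>f(v)\<close> is its value at \<open>f\<close>.\<close>

definition fun_calc ::
  "('a::complex_hilbert_space \<Rightarrow>\<^sub>L 'a) \<Rightarrow> (complex \<Rightarrow> complex) \<Rightarrow> ('a \<Rightarrow>\<^sub>L 'a)"
  where "fun_calc v f = (THE T. \<exists>\<Phi>. circle_star_hom \<Phi> \<and> \<Phi> (\<lambda>z. z) = v \<and> \<Phi> f = T)"


section \<open>\<open>C\<^sup>*\<close>-algebras of operators\<close>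

definition cstar_subalgebra :: "('a::complex_hilbert_space \<Rightarrow>\<^sub>L 'a) set \<Rightarrow> bool"
  where "cstar_subalgebra A \<longleftrightarrow> star_subalgebra A \<and> closed A"

definition cstar_generated :: "('a::complex_hilbert_space \<Rightarrow>\<^sub>L 'a) set \<Rightarrow> ('a \<Rightarrow>\<^sub>L 'a) set"
  where "cstar_generated S = \<Inter> {A. cstar_subalgebra A \<and> S \<subseteq> A}"

definition closed_ideal ::
  "('a::complex_hilbert_space \<Rightarrow>\<^sub>L 'a) set \<Rightarrow> ('a \<Rightarrow>\<^sub>L 'a) set \<Rightarrow> bool"
  where "closed_ideal I A \<longleftrightarrow> I \<subseteq> A \<and> closed I \<and> 0 \<in> I \<and>
    (\<forall>a\<in>I. \<forall>b\<in>I. a + b \<in> I) \<and>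
    (\<forall>c. \<forall>a\<in>I. scalar_op c o\<^sub>L a \<in> I) \<and>
    (\<forall>a\<in>I. \<forall>b\<in>A. a o\<^sub>L b \<in> I \<and> b o\<^sub>L a \<in> I)"

definition simple_cstar :: "('a::complex_hilbert_space \<Rightarrow>\<^sub>L 'a) set \<Rightarrow> bool"
  where "simple_cstar A \<longleftrightarrow> cstar_subalgebra A \<and> A \<noteq> {0} \<and>
    (\<forall>I. closed_ideal I A \<longrightarrow> I = {0} \<or> I = A)"

text \<open>The generalized universal irrational rotation algebra \<open>A\<^bsub>\<theta>,\<gamma>\<^esub>\<close>, in its concrete form
  \<open>C\<^sup>*(u\<gamma>\<^bsup>1/2\<^esup>(v), v)\<close>; the angle \<open>\<theta>\<close> enters through the commutation relation of
  the unitaries \<open>u\<close> and \<open>v\<close>.\<close>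

definition gen_rotation_algebra ::
  "('a::complex_hilbert_space \<Rightarrow>\<^sub>L 'a) \<Rightarrow> ('a \<Rightarrow>\<^sub>L 'a) \<Rightarrow> (complex \<Rightarrow> real) \<Rightarrow> ('a \<Rightarrow>\<^sub>L 'a) set"
  where "gen_rotation_algebra u v \<gamma> =
    cstar_generated {u o\<^sub>L fun_calc v (\<lambda>z. complex_of_real (sqrt (\<gamma> z))), v}"

end

theory Submission
  imports Defs "HOL-Complex_Analysis.Complex_Analysis" "HOL-Real_Asymp.Real_Asymp"
begin

text \<open>Write \<open>q = e\<^bsup>2\<pi>i\<theta>\<^esup>\<close>.  If \<open>\<gamma>\<close> vanishes at two points \<open>z\<close> and \<open>q\<^sup>n z\<close> of one orbit, the orbit segment
  between them carries an approximate finite-dimensional representation, whose kernel is a proper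
  ideal; so simplicity means that every orbit meets the zero set of \<open>\<gamma>\<close> at most once.
  Fix \<open>p\<close> with \<open>\<gamma> p > 0\<close> and put \<open>g z = \<gamma> z / (\<gamma> z + \<bar>z - p\<bar>\<^sup>2)\<close> and \<open>f = \<surd>g\<close>.  Then \<open>f\<close> and \<open>\<surd>\<gamma>\<close> differ
  by an invertible factor, and \<open>g\<close> has no rotational symmetry because it attains its maximum only
  at \<open>p\<close>.  Two points not separated by the functions of \<open>v\<close> in \<open>C\<^sup>*(u f(v), 1)\<close> stay unseparated along
  a half-orbit, which is dense, and this forces such a symmetry; hence \<open>v\<close> lies in the algebra by
  the Stone-Weierstrass theorem.\<close>

section \<open>Inner products and adjoints\<close>

text \<open>Symmetry is a real obstacle: for constant \<open>\<gamma> = 1\<close> the choice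
  \<open>f = \<surd>\<gamma>\<close> would give the algebra of \<open>u\<close> and the identity,
  which is commutative and misses \<open>v\<close>. The replacement may differ only by a factor
  invertible in C(S^1), since that factor has to pass from one generator to the other in both
  directions. The summand \<open>\<bar>z - p\<bar>\<^sup>2\<close> achieves both: on the circle g is
  at most 1, with equality only at p, while the denominator is positive everywhere because \<gamma>
  p > 0. So g and \<gamma> have the same zeros. Simplicity still allows one zero on an orbit. It can
  stop the propagation of non-separation in one direction but not in both, which is why density is
  needed for half-orbits. As \<open>v\<close> need not have eigenvectors, evaluation at a point of
  the circle is replaced by a sequence of unit vectors. Its existence at every point rests on
  faithfulness of f \<mapsto> f(v), which comes from density of orbits. Since \<open>adj\<close> and
  \<open>fun_calc\<close> are definite descriptions, the Riesz theorem and a sharp norm estimate for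
  polynomials in \<open>v\<close> have to come before any of this.\<close>

lemma cinner_add_right: "cinner x (y + z) = cinner x y + cinner x (z :: 'a::complex_hilbert_space)"
  by (metis cinner_add_left cinner_commute complex_cnj_add)

lemma cinner_scaleC_right: "cinner x (c *\<^sub>C y) = cnj c * cinner x (y :: 'a::complex_hilbert_space)"
  by (metis cinner_commute cinner_scaleC_left complex_cnj_mult)

lemma cinner_scaleR_left: "cinner (r *\<^sub>R x) y = of_real r * cinner x (y :: 'a::complex_hilbert_space)"
  by (metis cinner_scaleC_left scaleC_of_real)

lemma cinner_scaleR_right: "cinner x (r *\<^sub>R y) = of_real r * cinner x (y :: 'a::complex_hilbert_space)"
  by (metis cinner_scaleC_right scaleC_of_real complex_cnj_complex_of_real)

lemma cinner_minus_left: "cinner (- x) y = - cinner x (y :: 'a::complex_hilbert_space)"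
  using cinner_scaleR_left[of "-1" x y] by simp

lemma cinner_diff_left: "cinner (x - y) z = cinner x z - cinner y (z :: 'a::complex_hilbert_space)"
  using cinner_add_left[of x "- y" z] by (simp add: cinner_minus_left)

lemma cinner_diff_right: "cinner x (y - z) = cinner x y - cinner x (z :: 'a::complex_hilbert_space)"
  by (metis cinner_commute cinner_diff_left complex_cnj_diff)

lemma cinner_eqI:
  assumes "\<And>z. cinner z x = cinner z (y :: 'a::complex_hilbert_space)"
  shows "x = y"
proof -
  have "cinner (x - y) (x - y) = 0"
    using assms[of "x - y"] by (simp add: cinner_diff_right)
  then show ?thesis
    by (simp add: cinner_self)
qed

lemma norm_add_squared:
  "(norm (x + y))\<^sup>2 = (norm x)\<^sup>2 + (norm y)\<^sup>2 + 2 * Re (cinner x (y :: 'a::complex_hilbert_space))"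
proof -
  have "Re (cinner (x + y) (x + y)) = Re (cinner x x) + Re (cinner y y) + Re (cinner x y) + Re (cinner y x)"
    by (simp add: cinner_add_left cinner_add_right)
  moreover have "Re (cinner y x) = Re (cinner x y)"
    by (subst cinner_commute) simp
  ultimately show ?thesis
    by (simp add: cinner_self)
qed

lemma parallelogram:
  "(norm (x + y))\<^sup>2 + (norm (x - y))\<^sup>2 = 2 * (norm x)\<^sup>2 + 2 * (norm (y :: 'a::complex_hilbert_space))\<^sup>2"
proof -
  have "Re (cinner x (- y)) = - Re (cinner x y)"
    by (subst cinner_commute) (simp add: cinner_minus_left, subst cinner_commute, simp)
  then show ?thesis
    using norm_add_squared[of x y] norm_add_squared[of x "- y"] by simp
qed

lemma cinner_Cauchy_Schwarz: "cmod (cinner x y) \<le> norm x * norm (y :: 'a::complex_hilbert_space)"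
proof (cases "y = 0")
  case True
  then show ?thesis
    using cinner_scaleR_right[of x 0 y] by simp
next
  case False
  \<comment> \<open>\<open>c *\<^sub>C y\<close> is the orthogonal projection of \<open>x\<close>
    onto the line through \<open>y\<close>; the inequality says that the residual has non-negative
    squared norm.\<close>
  define c where "c = cinner x y / of_real ((norm y)\<^sup>2)"
  have "cinner (x - c *\<^sub>C y) (x - c *\<^sub>C y)
      = cinner x x - cnj c * cinner x y - c * cnj (cinner x y) + c * cnj c * cinner y y"
    using cinner_commute[of y x]
    by (simp add: cinner_diff_left cinner_diff_right cinner_scaleC_left cinner_scaleC_right algebra_simps)
  also have "\<dots> = of_real ((norm x)\<^sup>2 - (cmod (cinner x y))\<^sup>2 / (norm y)\<^sup>2)"
    using False complex_norm_square[of "cinner x y"]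
    by (simp add: c_def cinner_self field_simps power2_eq_square)
  finally have "(norm (x - c *\<^sub>C y))\<^sup>2 = (norm x)\<^sup>2 - (cmod (cinner x y))\<^sup>2 / (norm y)\<^sup>2"
    unfolding cinner_self by (simp only: of_real_eq_iff)
  then have "(cmod (cinner x y))\<^sup>2 / (norm y)\<^sup>2 \<le> (norm x)\<^sup>2"
    by (metis diff_ge_0_iff_ge zero_le_power2)
  then have "(cmod (cinner x y))\<^sup>2 \<le> (norm x * norm y)\<^sup>2"
    using False by (simp add: divide_le_eq power_mult_distrib)
  then show ?thesis
    by (simp add: power2_le_iff_abs_le)
qed

text \<open>The first-order condition at a minimum, without derivatives: near 0 the linear term
  dominates the quadratic one.\<close>

lemma nonneg_quadratic_imp_linear_zero:
  fixes a b :: real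
  assumes "\<And>t. 0 \<le> t\<^sup>2 * a + 2 * t * b" and "a \<ge> 0"
  shows "b = 0"
proof -
  \<comment> \<open>The minimiser would be \<open>- b / a\<close>; the shift to \<open>a + 1\<close>
    also covers \<open>a = 0\<close>.\<close>
  have "0 \<le> (- b / (a + 1))\<^sup>2 * a + 2 * (- b / (a + 1)) * b"
    by (rule assms(1))
  also have "\<dots> = - (b\<^sup>2 * (a + 2) / (a + 1)\<^sup>2)"
    using assms(2) by (simp add: divide_simps) (simp add: power2_eq_square algebra_simps)
  finally have "b\<^sup>2 * (a + 2) / (a + 1)\<^sup>2 \<le> 0"
    by simp
  then show ?thesis
    using assms(2) by (auto simp: divide_le_0_iff mult_le_0_iff not_le)
qed

text \<open>The representing vector is the minimum of \<open>\<parallel>x\<parallel>\<^sup>2 - 2 Re (\<phi> x)\<close>; a minimising sequence is Cauchy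
  by the parallelogram law.\<close>

theorem Riesz_representation:
  fixes \<phi> :: "'a::complex_hilbert_space \<Rightarrow> complex"
  assumes bl: "bounded_linear \<phi>" and hom: "\<And>c x. \<phi> (c *\<^sub>C x) = c * \<phi> x"
  shows "\<exists>y. \<forall>x. \<phi> x = cinner x y"
proof -
  interpret \<phi>: bounded_linear \<phi> by fact
  define J where "J x = (norm x)\<^sup>2 - 2 * Re (\<phi> x)" for x
  obtain K where K: "K > 0" "\<And>x. cmod (\<phi> x) \<le> norm x * K"
    using \<phi>.pos_bounded by blast
  have lower: "J x \<ge> - (K\<^sup>2)" for x
  proof -
    have "Re (\<phi> x) \<le> norm x * K"
      using K(2) complex_Re_le_cmod order_trans by blast
    moreover have "0 \<le> (norm x - K)\<^sup>2"
      by simp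
    ultimately show ?thesis
      by (simp add: J_def power2_diff)
  qed
  then have bdd: "bdd_below (range J)"
    by (auto simp: bdd_below_def)
  define m where "m = Inf (range J)"
  have m_le: "m \<le> J x" for x
    unfolding m_def by (rule cInf_lower[OF _ bdd]) simp
  have "\<exists>x. J x < m + 1 / real (Suc n)" for n
  proof -
    have "\<exists>y\<in>range J. y < m + 1 / real (Suc n)"
      unfolding m_def by (rule cInf_lessD) (auto simp: m_def)
    then show ?thesis by blast
  qed
  then obtain X where X: "\<And>n. J (X n) < m + 1 / real (Suc n)"
    by metis
  \<comment> \<open>The linear part of \<open>J\<close> cancels against its value at the midpoint,
    so the squared distance equals 2 J x + 2 J y minus four times \<open>J\<close> at the midpoint,
    which is at least \<open>m\<close>.\<close>
  have dist_le: "(norm (x - y))\<^sup>2 \<le> 2 * (J x - m) + 2 * (J y - m)" for x y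
  proof -
    have "J ((1/2) *\<^sub>R (x + y)) = (norm (x + y))\<^sup>2 / 4 - Re (\<phi> x) - Re (\<phi> y)"
      by (simp add: J_def \<phi>.scaleR \<phi>.add power_divide add_divide_distrib flip: scaleR_add_right)
    then show ?thesis
      using parallelogram[of x y] m_le[of "(1/2) *\<^sub>R (x + y)"] by (simp add: J_def)
  qed
  have "Cauchy X"
  proof (rule CauchyI)
    fix e :: real assume "e > 0"
    obtain N where N: "1 / real (Suc N) < e\<^sup>2 / 4"
      using \<open>e > 0\<close> nat_approx_posE[of "e\<^sup>2 / 4"] by (metis divide_pos_pos zero_less_numeral zero_less_power)
    have "norm (X p - X q) < e" if "p \<ge> N" "q \<ge> N" for p q
    proof -
      have le: "1 / real (Suc p) \<le> 1 / real (Suc N)" "1 / real (Suc q) \<le> 1 / real (Suc N)"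
        using that by (simp_all add: frac_le)
      have "(norm (X p - X q))\<^sup>2 < e\<^sup>2"
        using dist_le[of "X p" "X q"] X[of p] X[of q] le N by argo
      then show ?thesis
        using \<open>e > 0\<close> by (simp add: power2_less_imp_less)
    qed
    then show "\<exists>M. \<forall>p\<ge>M. \<forall>q\<ge>M. norm (X p - X q) < e"
      by blast
  qed
  then obtain L where L: "X \<longlonglongrightarrow> L"
    using Cauchy_convergent_iff convergent_def by blast
  have "(\<lambda>n. J (X n)) \<longlonglongrightarrow> J L"
    unfolding J_def by (intro tendsto_intros L \<phi>.tendsto)
  moreover have "(\<lambda>n. m + 1 / real (Suc n)) \<longlonglongrightarrow> m + 0"
    by (intro tendsto_intros LIMSEQ_Suc[OF lim_1_over_n])
  ultimately have "J L \<le> m + 0"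
    by (rule LIMSEQ_le) (use X less_imp_le in blast)
  then have min: "J L \<le> J x" for x
    using m_le[of x] by simp
  \<comment> \<open>First variation of \<open>J\<close> at its minimum \<open>L\<close> in the
    direction \<open>y\<close>.\<close>
  have re: "Re (\<phi> y) = Re (cinner y L)" for y
  proof -
    have "0 \<le> t\<^sup>2 * (norm y)\<^sup>2 + 2 * t * (Re (cinner y L) - Re (\<phi> y))" for t
      using min[of "t *\<^sub>R y + L"] norm_add_squared[of "t *\<^sub>R y" L]
      by (simp add: J_def \<phi>.add \<phi>.scaleR cinner_scaleR_left power_mult_distrib algebra_simps)
    then have "Re (cinner y L) - Re (\<phi> y) = 0"
      by (rule nonneg_quadratic_imp_linear_zero) simp
    then show ?thesis by simp
  qed
  \<comment> \<open>Replacing \<open>y\<close> by \<open>\<i> *\<^sub>C y\<close> turns the identity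
    of real parts into that of imaginary parts.\<close>
  have "\<phi> y = cinner y L" for y
    using re[of y] re[of "\<i> *\<^sub>C y"] by (simp add: complex_eq_iff hom cinner_scaleC_left)
  then show ?thesis by blast
qed

section \<open>Adjoints and norms of bounded operators\<close>

lemma bounded_ops_scaleC: "T \<in> bounded_ops \<Longrightarrow> blinfun_apply T (c *\<^sub>C x) = c *\<^sub>C blinfun_apply T x"
  by (simp add: bounded_ops_def)

text \<open>The inner product separates vectors, so the defining relation has at most one solution.
  This lets later adjoint identities be checked by inner products alone.\<close>

lemma adj_eqI:
  assumes "\<And>x y. cinner (blinfun_apply T x) y = cinner x (blinfun_apply S y)"
  shows "adj T = S"
  unfolding adj_def
proof (rule the_equality)
  show "\<forall>x y. cinner (blinfun_apply T x) y = cinner x (blinfun_apply S y)"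
    using assms by blast
next
  fix S' assume "\<forall>x y. cinner (blinfun_apply T x) y = cinner x (blinfun_apply S' y)"
  then have "cinner x (S' y) = cinner x (S y)" for x y
    using assms by metis
  then show "S' = S"
    by (metis blinfun_eqI cinner_eqI)
qed

text \<open>Riesz representation of x \<mapsto> <T x, y> for each fixed y. The norm bound is what
  later makes the adjoint continuous.\<close>

lemma adj_exists:
  fixes T :: "'a::complex_hilbert_space \<Rightarrow>\<^sub>L 'a"
  assumes T: "T \<in> bounded_ops"
  shows "\<exists>S\<in>bounded_ops. norm S \<le> norm T \<and>
    (\<forall>x y. cinner (blinfun_apply T x) y = cinner x (blinfun_apply S y))"
proof -
  have bl: "bounded_linear (\<lambda>x. cinner (blinfun_apply T x) y)" for y
  proof (rule bounded_linear_intro[where K = "norm T * norm y"])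
    fix x
    have "cmod (cinner (blinfun_apply T x) y) \<le> norm (blinfun_apply T x) * norm y"
      by (rule cinner_Cauchy_Schwarz)
    also have "\<dots> \<le> norm T * norm x * norm y"
      by (intro mult_right_mono norm_blinfun) simp
    finally show "cmod (cinner (blinfun_apply T x) y) \<le> norm x * (norm T * norm y)"
      by (simp add: mult_ac)
  qed (simp_all add: blinfun.add_right blinfun.scaleR_right cinner_add_left cinner_scaleR_left
      scaleR_conv_of_real)
  have "\<exists>z. \<forall>x. cinner (blinfun_apply T x) y = cinner x z" for y
    by (rule Riesz_representation[OF bl]) (simp add: bounded_ops_scaleC[OF T] cinner_scaleC_left)
  then obtain s where s: "\<And>x y. cinner (blinfun_apply T x) y = cinner x (s y)"
    by metis
  have scale: "s (c *\<^sub>C x) = c *\<^sub>C s x" for c x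
    by (rule cinner_eqI) (simp add: cinner_scaleC_right flip: s)
  have norm_s: "norm (s y) \<le> norm T * norm y" for y
  proof -
    have "(norm (s y))\<^sup>2 = cmod (cinner (blinfun_apply T (s y)) y)"
      by (simp add: s cinner_self norm_power)
    also have "\<dots> \<le> norm (blinfun_apply T (s y)) * norm y"
      by (rule cinner_Cauchy_Schwarz)
    also have "\<dots> \<le> norm T * norm (s y) * norm y"
      by (intro mult_right_mono norm_blinfun) simp
    finally have "norm (s y) * norm (s y) \<le> (norm T * norm y) * norm (s y)"
      by (simp add: power2_eq_square mult_ac)
    then show ?thesis
      by (cases "s y = 0") simp_all
  qed
  have bl_s: "bounded_linear s"
  proof (rule bounded_linear_intro)
    show "s (x + y) = s x + s y" for x y
      by (rule cinner_eqI) (simp add: cinner_add_right flip: s)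
    show "s (r *\<^sub>R x) = r *\<^sub>R s x" for r x
      using scale[of "of_real r" x] by (simp add: scaleC_of_real)
    show "norm (s x) \<le> norm x * norm T" for x
      using norm_s[of x] by (simp add: mult.commute)
  qed
  show ?thesis
  proof (intro bexI[of _ "Blinfun s"] conjI allI)
    show "norm (Blinfun s) \<le> norm T"
      by (rule norm_blinfun_bound) (simp_all add: bounded_linear_Blinfun_apply bl_s norm_s)
    show "Blinfun s \<in> bounded_ops"
      by (simp add: bounded_ops_def bounded_linear_Blinfun_apply bl_s scale)
  qed (simp add: bounded_linear_Blinfun_apply bl_s s)
qed

lemma adj_props:
  assumes "T \<in> bounded_ops"
  shows cinner_adj: "cinner (blinfun_apply T x) y = cinner x (blinfun_apply (adj T) y)"
    and adj_in_bounded_ops: "adj T \<in> bounded_ops"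
    and norm_adj_le: "norm (adj T) \<le> norm T"
  using adj_exists[OF assms] adj_eqI by metis+

lemma cinner_adj':
  assumes "T \<in> bounded_ops"
  shows "cinner x (blinfun_apply T y) = cinner (blinfun_apply (adj T) x) y"
  by (metis assms cinner_adj cinner_commute)

lemma adj_adj: "T \<in> bounded_ops \<Longrightarrow> adj (adj T) = T"
  by (rule adj_eqI) (simp add: cinner_adj')

lemma id_in_bounded_ops: "id_blinfun \<in> bounded_ops"
  and zero_in_bounded_ops: "0 \<in> bounded_ops"
  by (auto simp: bounded_ops_def) (metis norm_scaleC norm_zero mult_zero_right norm_eq_zero)

lemma add_in_bounded_ops: "S \<in> bounded_ops \<Longrightarrow> T \<in> bounded_ops \<Longrightarrow> S + T \<in> bounded_ops"
  by (simp add: bounded_ops_def blinfun.add_left scaleC_add_right)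

lemma compose_in_bounded_ops: "S \<in> bounded_ops \<Longrightarrow> T \<in> bounded_ops \<Longrightarrow> S o\<^sub>L T \<in> bounded_ops"
  by (simp add: bounded_ops_def)

lemma scalar_op_in_bounded_ops: "scalar_op c \<in> bounded_ops"
  by (simp add: bounded_ops_def scalar_op_apply scaleC_scaleC mult.commute)

lemma diff_in_bounded_ops: "S \<in> bounded_ops \<Longrightarrow> T \<in> bounded_ops \<Longrightarrow> S - T \<in> bounded_ops"
proof -
  have "c *\<^sub>C (x - y) = c *\<^sub>C x - c *\<^sub>C (y :: 'a)" for c x y
    by (metis bounded_linear_scaleC linear_simps(2))
  then show "S \<in> bounded_ops \<Longrightarrow> T \<in> bounded_ops \<Longrightarrow> S - T \<in> bounded_ops"
    by (simp add: bounded_ops_def blinfun.diff_left)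
qed

lemma scalar_op_commute: "T \<in> bounded_ops \<Longrightarrow> T o\<^sub>L scalar_op c = scalar_op c o\<^sub>L T"
  by (rule blinfun_eqI) (simp add: scalar_op_apply bounded_ops_scaleC)

lemma scalar_op_0: "scalar_op 0 = 0"
  by (rule blinfun_eqI) (simp add: scalar_op_apply, metis norm_scaleC norm_zero mult_zero_left norm_eq_zero)

lemma scalar_op_1: "scalar_op 1 = id_blinfun"
  by (rule blinfun_eqI) (use scaleC_of_real[of 1] in \<open>simp add: scalar_op_apply\<close>)

lemma scalar_op_mult: "scalar_op (c * d) = scalar_op c o\<^sub>L scalar_op d"
  by (rule blinfun_eqI) (simp add: scalar_op_apply scaleC_scaleC)

lemma scalar_op_add: "scalar_op (c + d) = scalar_op c + scalar_op d"
  by (rule blinfun_eqI) (simp add: scalar_op_apply scaleC_add_left blinfun.add_left)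

lemma adj_scalar_op: "adj (scalar_op c) = scalar_op (cnj c)"
  by (rule adj_eqI) (simp add: scalar_op_apply cinner_scaleC_left cinner_scaleC_right)

lemma adj_add: "S \<in> bounded_ops \<Longrightarrow> T \<in> bounded_ops \<Longrightarrow> adj (S + T) = adj S + adj T"
  by (rule adj_eqI) (simp add: blinfun.add_left cinner_add_left cinner_add_right cinner_adj)

lemma adj_diff: "S \<in> bounded_ops \<Longrightarrow> T \<in> bounded_ops \<Longrightarrow> adj (S - T) = adj S - adj T"
  by (rule adj_eqI) (simp add: blinfun.diff_left cinner_diff_left cinner_diff_right cinner_adj)

lemma adj_compose: "S \<in> bounded_ops \<Longrightarrow> T \<in> bounded_ops \<Longrightarrow> adj (S o\<^sub>L T) = adj T o\<^sub>L adj S"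
  by (rule adj_eqI) (simp add: cinner_adj)

lemma compose_scalar_op_left:
  assumes "S \<in> bounded_ops"
  shows "S o\<^sub>L (scalar_op c o\<^sub>L T) = scalar_op c o\<^sub>L (S o\<^sub>L T)"
  by (rule blinfun_eqI) (simp add: scalar_op_apply bounded_ops_scaleC[OF assms])

lemma closed_bounded_ops: "closed (bounded_ops :: ('a::complex_hilbert_space \<Rightarrow>\<^sub>L 'a) set)"
proof -
  have "bounded_ops = (\<Inter>c. \<Inter>x. {T :: 'a \<Rightarrow>\<^sub>L 'a. T (c *\<^sub>C x) = c *\<^sub>C T x})"
    by (auto simp: bounded_ops_def)
  moreover have "closed (\<Inter>c. \<Inter>x. {T :: 'a \<Rightarrow>\<^sub>L 'a. T (c *\<^sub>C x) = c *\<^sub>C T x})"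
    by (intro closed_INT ballI closed_Collect_eq continuous_intros
        bounded_linear.continuous_on[OF bounded_linear_scaleC])
  ultimately show ?thesis
    by simp
qed

lemma tendsto_adj:
  assumes "\<And>n. T n \<in> bounded_ops" and "T \<longlonglongrightarrow> S"
  shows "(\<lambda>n. adj (T n)) \<longlonglongrightarrow> adj S"
proof -
  have S: "S \<in> bounded_ops"
    using assms closed_bounded_ops closed_sequentially by blast
  have "(\<lambda>n. norm (T n - S)) \<longlonglongrightarrow> 0"
    using assms(2) LIM_zero tendsto_norm_zero by blast
  then have "(\<lambda>n. adj (T n) - adj S) \<longlonglongrightarrow> 0"
    by (rule Lim_null_comparison[rotated])
      (simp add: S assms(1) norm_adj_le diff_in_bounded_ops flip: adj_diff)
  then show ?thesis
    by (rule LIM_zero_cancel)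
qed

lemma unitary_op_simps:
  assumes "unitary_op u"
  shows "u \<in> bounded_ops" "adj u \<in> bounded_ops" "blinfun_apply (adj u) (blinfun_apply u x) = x"
    "blinfun_apply u (blinfun_apply (adj u) x) = x"
    "adj u o\<^sub>L u = id_blinfun" "u o\<^sub>L adj u = id_blinfun"
  using assms by (auto simp: unitary_op_def adj_in_bounded_ops dest: arg_cong[where f = "\<lambda>T. blinfun_apply T x"])

lemma norm_isometry:
  assumes "T \<in> bounded_ops" and "adj T o\<^sub>L T = id_blinfun"
  shows "norm (blinfun_apply T x) = norm x"
proof -
  have "cinner (blinfun_apply T x) (blinfun_apply T x) = cinner x x"
    using arg_cong[OF assms(2), of "\<lambda>T. blinfun_apply T x"] by (simp add: cinner_adj assms(1))
  then have "(norm (blinfun_apply T x))\<^sup>2 = (norm x)\<^sup>2"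
    unfolding cinner_self by (simp only: of_real_eq_iff)
  then show ?thesis
    by (simp add: power2_eq_iff_nonneg)
qed

lemma norm_unitary_op: "unitary_op u \<Longrightarrow> norm (blinfun_apply u x) = norm x"
  by (simp add: norm_isometry unitary_op_def)

text \<open>For normal \<open>T\<close> the vectors \<open>T y\<close> and \<open>adj T y\<close>
  have equal norm, so in \<open><x, adj T (T x)>\<close> the adjoint can be traded for a second
  \<open>T\<close>.\<close>

lemma norm_square_normal:
  assumes T: "T \<in> bounded_ops" and normal: "adj T o\<^sub>L T = T o\<^sub>L adj T"
  shows "norm (T o\<^sub>L T) = (norm T)\<^sup>2"
proof (rule antisym)
  show "norm (T o\<^sub>L T) \<le> (norm T)\<^sup>2"
    by (metis norm_blinfun_compose power2_eq_square)
  have same: "norm (T y) = norm (adj T y)" for y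
  proof -
    have "cinner (T y) (T y) = cinner (adj T y) (adj T y)"
      using arg_cong[OF normal, of "\<lambda>S. blinfun_apply S y"]
      by (metis T blinfun_apply_blinfun_compose cinner_adj cinner_adj')
    then show ?thesis
      unfolding cinner_self by (simp only: of_real_eq_iff) (simp add: power2_eq_iff_nonneg)
  qed
  have bound: "(norm (T x))\<^sup>2 \<le> norm (T o\<^sub>L T) * (norm x)\<^sup>2" for x
  proof -
    have "(norm (T x))\<^sup>2 = cmod (cinner x (adj T (T x)))"
      by (metis T cinner_adj cinner_self norm_of_real abs_power2)
    also have "\<dots> \<le> norm x * norm (T (T x))"
      by (metis same cinner_Cauchy_Schwarz)
    also have "\<dots> \<le> norm x * (norm (T o\<^sub>L T) * norm x)"
      by (intro mult_left_mono) (metis blinfun_apply_blinfun_compose norm_blinfun, simp)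
    finally show ?thesis
      by (simp add: power2_eq_square mult_ac)
  qed
  have "norm T \<le> sqrt (norm (T o\<^sub>L T))"
  proof (rule norm_blinfun_bound)
    fix x
    have "norm (T x) = sqrt ((norm (T x))\<^sup>2)"
      by simp
    also have "\<dots> \<le> sqrt (norm (T o\<^sub>L T) * (norm x)\<^sup>2)"
      by (intro real_sqrt_le_mono bound)
    finally show "norm (T x) \<le> sqrt (norm (T o\<^sub>L T)) * norm x"
      by (simp add: real_sqrt_mult)
  qed simp
  then show "(norm T)\<^sup>2 \<le> norm (T o\<^sub>L T)"
    by (metis norm_ge_zero power_mono real_sqrt_pow2)
qed

section \<open>Functional calculus of a unitary operator\<close>

lemma id_op_compose [simp]: "id_blinfun o\<^sub>L T = T" "T o\<^sub>L id_blinfun = T"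
  by (auto intro: blinfun_eqI)

lemma compose_add_left: "(S + T) o\<^sub>L U = (S o\<^sub>L U) + (T o\<^sub>L U)"
  and compose_add_right: "U o\<^sub>L (S + T) = (U o\<^sub>L S) + (U o\<^sub>L T)"
  by (auto intro!: blinfun_eqI simp: blinfun.add_left blinfun.add_right)

section \<open>Polynomials in a unitary operator and their norms\<close>

text \<open>Horner's scheme for p(v), chosen so that proofs can follow the \<open>pCons\<close>
  induction.\<close>

definition op_poly :: "('a::complex_hilbert_space \<Rightarrow>\<^sub>L 'a) \<Rightarrow> complex poly \<Rightarrow> ('a \<Rightarrow>\<^sub>L 'a)"
  where "op_poly v p = fold_coeffs (\<lambda>a T. scalar_op a + (v o\<^sub>L T)) p 0"

lemma op_poly_0 [simp]: "op_poly v 0 = 0"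
  by (simp add: op_poly_def)

lemma op_poly_pCons [simp]: "op_poly v (pCons a p) = scalar_op a + (v o\<^sub>L op_poly v p)"
  by (cases "p = 0 \<and> a = 0") (auto simp: op_poly_def scalar_op_0 blinfun_compose_zero)

lemma op_poly_in_bounded_ops: "v \<in> bounded_ops \<Longrightarrow> op_poly v p \<in> bounded_ops"
  by (induction p)
    (simp_all add: zero_in_bounded_ops add_in_bounded_ops compose_in_bounded_ops scalar_op_in_bounded_ops)

lemma op_poly_add: "op_poly v (p + q) = op_poly v p + op_poly v q"
proof (induction p q rule: poly_induct2)
  case (pCons a p b q)
  then show ?case
    by (intro blinfun_eqI) (simp add: scalar_op_add blinfun.add_left blinfun.add_right)
qed simp

lemma op_poly_smult: "v \<in> bounded_ops \<Longrightarrow> op_poly v (smult c p) = scalar_op c o\<^sub>L op_poly v p"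
  by (induction p)
    (simp_all add: scalar_op_mult compose_scalar_op_left compose_add_right)

lemma op_poly_mult:
  assumes "v \<in> bounded_ops"
  shows "op_poly v (p * q) = op_poly v p o\<^sub>L op_poly v q"
proof (induction p)
  case (pCons a p)
  then show ?case
    by (intro blinfun_eqI)
      (simp add: assms op_poly_add op_poly_smult scalar_op_0 blinfun.add_left)
qed simp

lemma op_poly_commute:
  assumes "T \<in> bounded_ops" and "T o\<^sub>L v = v o\<^sub>L T"
  shows "T o\<^sub>L op_poly v p = op_poly v p o\<^sub>L T"
proof (induction p)
  case (pCons a p)
  have 1: "T (v x) = v (T x)" and 2: "T (op_poly v p x) = op_poly v p (T x)" for x
    using arg_cong[OF assms(2), of "\<lambda>S. S x"] arg_cong[OF pCons.IH, of "\<lambda>S. S x"] by simp_all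
  show ?case
    by (intro blinfun_eqI)
      (simp add: blinfun.add_left blinfun.add_right scalar_op_apply bounded_ops_scaleC assms(1) 1 2)
qed simp

lemma norm_scalar_op_le: "norm (scalar_op c :: 'a::complex_hilbert_space \<Rightarrow>\<^sub>L 'a) \<le> cmod c"
  by (rule norm_blinfun_bound) (simp_all add: scalar_op_apply norm_scaleC)

lemma norm_op_poly_le:
  fixes v :: "'a::complex_hilbert_space \<Rightarrow>\<^sub>L 'a" and B :: real
  assumes "norm v \<le> 1" and "\<And>i. cmod (coeff p i) \<le> B"
  shows "norm (op_poly v p) \<le> (degree p + 1) * B"
proof -
  have "norm (op_poly v p) \<le> (\<Sum>i\<le>degree p. cmod (coeff p i))"
  proof (induction p)
    case (pCons a p)
    have "norm (op_poly v (pCons a p)) \<le> norm (scalar_op a :: 'a \<Rightarrow>\<^sub>L 'a) + norm (v o\<^sub>L op_poly v p)"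
      by (simp add: norm_triangle_ineq)
    also have "\<dots> \<le> cmod a + 1 * norm (op_poly v p)"
      by (intro add_mono norm_scalar_op_le order_trans[OF norm_blinfun_compose] mult_right_mono assms) simp
    also have "\<dots> \<le> cmod a + (\<Sum>i\<le>degree p. cmod (coeff p i))"
      using pCons.IH by simp
    also have "\<dots> = (\<Sum>i\<le>degree (pCons a p). cmod (coeff (pCons a p) i))"
      by (cases "p = 0") (simp_all add: sum.atMost_Suc_shift del: sum.atMost_Suc)
    finally show ?case .
  qed simp
  also have "\<dots> \<le> (\<Sum>i\<le>degree p. B)"
    by (intro sum_mono assms)
  finally show ?thesis by simp
qed

lemma higher_deriv_poly: "(deriv ^^ n) (poly p) = poly ((pderiv ^^ n) (p :: complex poly))"
proof (induction n)
  case (Suc n)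
  have "deriv (poly ((pderiv ^^ n) p)) = poly (pderiv ((pderiv ^^ n) p))"
    by (rule ext, rule DERIV_imp_deriv, rule poly_DERIV)
  then show ?case
    by (simp add: Suc)
qed simp

text \<open>Cauchy's estimate on the unit disc: the coefficients of \<open>p\<close> are its Taylor
  coefficients at 0.\<close>

lemma norm_coeff_le_sphere:
  fixes p :: "complex poly"
  assumes "\<And>z. z \<in> sphere 0 1 \<Longrightarrow> cmod (poly p z) \<le> B"
  shows "cmod (coeff p n) \<le> B"
proof -
  have "norm ((deriv ^^ n) (poly p) 0) \<le> fact n * B / 1 ^ n"
    by (rule Cauchy_inequality) (auto intro!: holomorphic_intros continuous_intros assms)
  moreover have "(deriv ^^ n) (poly p) 0 = fact n * coeff p n"
    by (simp add: higher_deriv_poly poly_0_coeff_0 coeff_higher_pderiv pochhammer_fact)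
  ultimately show ?thesis
    by (simp add: norm_mult)
qed

text \<open>The coefficients give a bound with a factor \<open>degree p + 1\<close>, which disappears on taking
  \<open>2\<^sup>k\<close>-th roots of the bounds for \<open>p ^ (2 ^ k)\<close>, since \<open>\<parallel>T\<^sup>2\<parallel> = \<parallel>T\<parallel>\<^sup>2\<close> for normal \<open>T\<close>.\<close>

lemma norm_op_poly_le_sphere:
  fixes v :: "'a::complex_hilbert_space \<Rightarrow>\<^sub>L 'a"
  assumes v: "unitary_op v" and B: "\<And>z. z \<in> sphere 0 1 \<Longrightarrow> cmod (poly p z) \<le> B"
  shows "norm (op_poly v p) \<le> B"
proof (rule ccontr)
  assume "\<not> norm (op_poly v p) \<le> B"
  then have less: "B < norm (op_poly v p)" by simp
  have "0 \<le> cmod (poly p 1)" by simp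
  also have "\<dots> \<le> B" by (rule B) simp
  finally have "B \<ge> 0" .
  note vb = unitary_op_simps[OF v]
  have norm_v: "norm v \<le> 1"
    by (rule norm_blinfun_bound) (simp_all add: norm_unitary_op[OF v])
  \<comment> \<open>\<open>op_poly v q\<close> commutes with \<open>adj v\<close>; taking adjoints,
    \<open>adj (op_poly v q)\<close> commutes with \<open>v\<close>, hence with every polynomial in
    \<open>v\<close>.\<close>
  have normal: "adj (op_poly v q) o\<^sub>L op_poly v q = op_poly v q o\<^sub>L adj (op_poly v q)" for q
  proof -
    have "adj v o\<^sub>L op_poly v q = op_poly v q o\<^sub>L adj v"
      by (rule op_poly_commute) (simp_all add: vb)
    then have "adj (adj v o\<^sub>L op_poly v q) = adj (op_poly v q o\<^sub>L adj v)"
      by simp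
    then have "adj (op_poly v q) o\<^sub>L v = v o\<^sub>L adj (op_poly v q)"
      by (simp add: adj_compose op_poly_in_bounded_ops vb adj_adj)
    then show ?thesis
      by (intro op_poly_commute) (simp_all add: adj_in_bounded_ops op_poly_in_bounded_ops vb)
  qed
  have pow: "norm (op_poly v (p ^ (2 ^ k))) = norm (op_poly v p) ^ (2 ^ k)" for k
  proof (induction k)
    case (Suc k)
    have "p ^ (2 ^ Suc k) = p ^ (2 ^ k) * p ^ (2 ^ k)"
      by (simp add: mult_2 power_add)
    then have "norm (op_poly v (p ^ (2 ^ Suc k))) = (norm (op_poly v (p ^ (2 ^ k))))\<^sup>2"
      by (simp add: op_poly_mult vb norm_square_normal normal op_poly_in_bounded_ops)
    then show ?case
      by (simp add: Suc flip: power_mult) (simp add: mult.commute)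
  qed simp
  have bound: "norm (op_poly v p) ^ (2 ^ k) \<le> (real (2 ^ k) * degree p + 1) * B ^ (2 ^ k)" for k
  proof -
    have "norm (op_poly v (p ^ (2 ^ k))) \<le> (degree (p ^ (2 ^ k)) + 1) * B ^ (2 ^ k)"
    proof (rule norm_op_poly_le[OF norm_v norm_coeff_le_sphere])
      show "cmod (poly (p ^ (2 ^ k)) z) \<le> B ^ (2 ^ k)" if "z \<in> sphere 0 1" for z
        using B[OF that] by (simp add: poly_power norm_power power_mono)
    qed
    also have "\<dots> \<le> (real (2 ^ k) * degree p + 1) * B ^ (2 ^ k)"
      using of_nat_mono[OF degree_power_le[of p "2 ^ k"], where 'a = real] \<open>B \<ge> 0\<close>
      by (intro mult_right_mono add_right_mono)
        (simp_all only: mult.commute of_nat_mult[symmetric] of_nat_le_iff of_nat_add of_nat_1 zero_le_power)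
    finally show ?thesis by (simp add: pow)
  qed
  \<comment> \<open>For \<open>B = 0\<close> the case \<open>k = 0\<close> of \<open>bound\<close>
    already contradicts the assumption.\<close>
  have "B \<noteq> 0"
    using bound[of 0] less by auto
  \<comment> \<open>The contradiction: \<open>r > 1\<close>, so its powers grow exponentially, but
    \<open>bound\<close> lets them grow only linearly in the exponent \<open>2 ^ k\<close>.\<close>
  define r where "r = norm (op_poly v p) / B"
  have "r > 1"
    using less \<open>B \<ge> 0\<close> \<open>B \<noteq> 0\<close> by (simp add: r_def)
  have r_bound: "r ^ (2 ^ k) \<le> real (2 ^ k) * degree p + 1" for k
    using bound[of k] \<open>B \<ge> 0\<close> \<open>B \<noteq> 0\<close> by (simp add: r_def power_divide divide_le_eq)
  have "((\<lambda>n. (real n * degree p + 1) / r ^ n) \<longlongrightarrow> 0) at_top"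
    using \<open>r > 1\<close> by real_asymp
  then have "((\<lambda>k. (real (2 ^ k) * degree p + 1) / r ^ (2 ^ k)) \<longlongrightarrow> 0) at_top"
    by (rule filterlim_compose) real_asymp
  then have "\<forall>\<^sub>F k in at_top. (real (2 ^ k) * degree p + 1) / r ^ (2 ^ k) < 1"
    by (rule order_tendstoD) simp
  then obtain k where "(real (2 ^ k) * degree p + 1) / r ^ (2 ^ k) < 1"
    by (auto simp: eventually_at_top_linorder)
  with r_bound[of k] \<open>r > 1\<close> show False
    by (simp add: divide_less_eq)
qed

section \<open>Laurent polynomials in a unitary operator\<close>

text \<open>A relation, because one function has many expressions and equality of the resulting
  operators is not known yet; it follows from the norm bound applied to a difference. On the circle
  \<open>cnj\<close> is the inverse, so these are the Laurent polynomials.\<close>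

inductive laurent_calc ::
  "('a::complex_hilbert_space \<Rightarrow>\<^sub>L 'a) \<Rightarrow> (complex \<Rightarrow> complex) \<Rightarrow> ('a \<Rightarrow>\<^sub>L 'a) \<Rightarrow> bool" for v
  where
    const: "laurent_calc v (\<lambda>z. c) (scalar_op c)"
  | ident: "laurent_calc v (\<lambda>z. z) v"
  | inv: "laurent_calc v cnj (adj v)"
  | add: "laurent_calc v f S \<Longrightarrow> laurent_calc v g T \<Longrightarrow> laurent_calc v (\<lambda>z. f z + g z) (S + T)"
  | mult: "laurent_calc v f S \<Longrightarrow> laurent_calc v g T \<Longrightarrow> laurent_calc v (\<lambda>z. f z * g z) (S o\<^sub>L T)"

lemma laurent_calc_continuous: "laurent_calc v f T \<Longrightarrow> continuous_on S f"
  by (induction rule: laurent_calc.induct) (auto intro!: continuous_intros)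

lemma laurent_calc_in_star_subalgebra:
  assumes "laurent_calc v f T" and "star_subalgebra A" and "v \<in> A" and "id_blinfun \<in> A"
  shows "T \<in> A"
  using assms(1)
proof induction
  case (const c)
  have "scalar_op c o\<^sub>L id_blinfun \<in> A"
    using assms unfolding star_subalgebra_def by blast
  then show ?case by simp
qed (use assms in \<open>auto simp: star_subalgebra_def\<close>)

lemma star_subalgebra_bounded_ops: "star_subalgebra bounded_ops"
  by (simp add: star_subalgebra_def zero_in_bounded_ops add_in_bounded_ops compose_in_bounded_ops
      scalar_op_in_bounded_ops adj_in_bounded_ops)

lemma laurent_calc_in_bounded_ops: "laurent_calc v f T \<Longrightarrow> v \<in> bounded_ops \<Longrightarrow> T \<in> bounded_ops"
  by (rule laurent_calc_in_star_subalgebra[OF _ star_subalgebra_bounded_ops])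
    (simp_all add: id_in_bounded_ops)

lemma laurent_calc_commute:
  assumes "laurent_calc v f S" and "unitary_op v" and "T \<in> bounded_ops"
    and "T o\<^sub>L v = v o\<^sub>L T" and "T o\<^sub>L adj v = adj v o\<^sub>L T"
  shows "T o\<^sub>L S = S o\<^sub>L T"
  using assms(1)
proof induction
  case (const c)
  then show ?case using assms(3) by (simp add: scalar_op_commute)
next
  case (add f S g S')
  then show ?case by (simp add: compose_add_left compose_add_right)
next
  case (mult f S g S')
  then have "T (S x) = S (T x)" "T (S' x) = S' (T x)" for x
    by (metis blinfun_apply_blinfun_compose)+
  then show ?case by (intro blinfun_eqI) simp
qed (use assms in auto)

lemma laurent_calc_commutes:
  assumes f: "laurent_calc v f S" and g: "laurent_calc v g T" and v: "unitary_op v"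
  shows "S o\<^sub>L T = T o\<^sub>L S"
proof (rule laurent_calc_commute[OF g v])
  note vb = unitary_op_simps[OF v]
  show S: "S \<in> bounded_ops"
    by (rule laurent_calc_in_bounded_ops[OF f vb(1)])
  show "S o\<^sub>L v = v o\<^sub>L S" "S o\<^sub>L adj v = adj v o\<^sub>L S"
    using laurent_calc_commute[OF f v] vb by simp_all
qed

lemma laurent_calc_adj:
  assumes f: "laurent_calc v f T" and v: "unitary_op v"
  shows "laurent_calc v (\<lambda>z. cnj (f z)) (adj T)"
  using f
proof induction
  case (const c)
  then show ?case by (simp add: adj_scalar_op laurent_calc.const)
next
  case ident
  then show ?case by (rule laurent_calc.inv)
next
  case inv
  then show ?case using v by (simp add: adj_adj unitary_op_simps laurent_calc.ident)
next
  case (add f S g T)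
  then show ?case
    using laurent_calc_in_bounded_ops[OF _ unitary_op_simps(1)[OF v]]
    by (simp add: adj_add laurent_calc.add)
next
  case (mult f S g T)
  \<comment> \<open>The adjoint reverses the factors, and commutativity restores the order required
    by the \<open>mult\<close> rule.\<close>
  then have "adj (S o\<^sub>L T) = adj S o\<^sub>L adj T"
    using laurent_calc_commutes[OF mult.hyps v] laurent_calc_in_bounded_ops[OF _ unitary_op_simps(1)[OF v]]
    by (simp add: adj_compose)
  then show ?case
    using mult by (simp add: laurent_calc.mult)
qed

text \<open>Clearing denominators, for the function and for the operator at once. On the circle z^d
  has modulus 1 and \<open>op_poly v (monom 1 d)\<close> is isometric, so norm bounds for
  polynomials carry over to Laurent polynomials.\<close>

lemma laurent_calc_poly:
  assumes "laurent_calc v f T" and v: "unitary_op v"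
  shows "\<exists>d p. (\<forall>z\<in>sphere 0 1. z ^ d * f z = poly p z) \<and> op_poly v (monom 1 d) o\<^sub>L T = op_poly v p"
  using assms(1)
proof induction
  note vb = unitary_op_simps[OF v]
  {
    case (const c)
    show ?case
      by (rule exI[of _ 0], rule exI[of _ "[:c:]"]) (simp add: monom_0 scalar_op_1)
  next
    case ident
    show ?case
      by (rule exI[of _ 0], rule exI[of _ "[:0, 1:]"])
        (simp add: monom_0 scalar_op_1 scalar_op_0)
  next
    case inv
    show ?case
      by (rule exI[of _ 1], rule exI[of _ "[:1:]"])
        (auto simp: monom_Suc monom_0 scalar_op_1 scalar_op_0 vb simp flip: complex_norm_square)
  next
    case (add f S g T)
    then obtain d p e q where
      p: "\<And>z. z \<in> sphere 0 1 \<Longrightarrow> z ^ d * f z = poly p z" "op_poly v (monom 1 d) o\<^sub>L S = op_poly v p" and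
      q: "\<And>z. z \<in> sphere 0 1 \<Longrightarrow> z ^ e * g z = poly q z" "op_poly v (monom 1 e) o\<^sub>L T = op_poly v q"
      by metis
    have "z ^ (d + e) * (f z + g z) = poly (monom 1 e * p + monom 1 d * q) z" if "z \<in> sphere 0 1" for z
      using that by (simp add: poly_monom algebra_simps power_add flip: p q)
    moreover have "op_poly v (monom 1 (d + e)) o\<^sub>L (S + T) = op_poly v (monom 1 e * p + monom 1 d * q)"
    proof -
      have 1: "monom 1 (d + e) = monom 1 d * monom (1::complex) e"
        "monom 1 (d + e) = monom 1 e * monom (1::complex) d"
        by (simp_all add: mult_monom add.commute)
      have "op_poly v (monom 1 (d + e)) o\<^sub>L S = op_poly v (monom 1 e * p)"
        unfolding 1(2) op_poly_mult[OF vb(1)] p(2)[symmetric] by (rule blinfun_eqI) simp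
      moreover have "op_poly v (monom 1 (d + e)) o\<^sub>L T = op_poly v (monom 1 d * q)"
        unfolding 1(1) op_poly_mult[OF vb(1)] q(2)[symmetric] by (rule blinfun_eqI) simp
      ultimately show ?thesis
        by (simp add: op_poly_add compose_add_right)
    qed
    ultimately show ?case by blast
  next
    case (mult f S g T)
    then obtain d p e q where
      p: "\<And>z. z \<in> sphere 0 1 \<Longrightarrow> z ^ d * f z = poly p z" "op_poly v (monom 1 d) o\<^sub>L S = op_poly v p" and
      q: "\<And>z. z \<in> sphere 0 1 \<Longrightarrow> z ^ e * g z = poly q z" "op_poly v (monom 1 e) o\<^sub>L T = op_poly v q"
      by metis
    have "z ^ (d + e) * (f z * g z) = poly (p * q) z" if "z \<in> sphere 0 1" for z
      using that by (simp add: algebra_simps power_add flip: p q)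
    moreover have "op_poly v (monom 1 (d + e)) o\<^sub>L (S o\<^sub>L T) = op_poly v (p * q)"
    proof -
      have S: "S o\<^sub>L v = v o\<^sub>L S" "S \<in> bounded_ops"
        using laurent_calc_commutes[OF mult.hyps(1) laurent_calc.ident v]
          laurent_calc_in_bounded_ops[OF mult.hyps(1) vb(1)] by auto
      \<comment> \<open>The power v^(d+e) splits as v^d v^e, and v^e has to move past
        \<open>S\<close> to reach \<open>T\<close>.\<close>
      have comm: "S (op_poly v (monom 1 e) x) = op_poly v (monom 1 e) (S x)" for x
        using op_poly_commute[OF S(2,1)] by (metis blinfun_apply_blinfun_compose)
      have "monom 1 (d + e) = monom 1 d * monom (1::complex) e"
        by (simp add: mult_monom)
      then show ?thesis
        by (simp add: op_poly_mult vb flip: p q) (rule blinfun_eqI, simp add: comm)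
    qed
    ultimately show ?case by blast
  }
qed

lemma norm_laurent_calc_le:
  assumes f: "laurent_calc v f T" and v: "unitary_op v" and B: "\<And>z. z \<in> sphere 0 1 \<Longrightarrow> cmod (f z) \<le> B"
  shows "norm T \<le> B"
proof -
  note vb = unitary_op_simps[OF v]
  obtain d p where p: "\<And>z. z \<in> sphere 0 1 \<Longrightarrow> z ^ d * f z = poly p z"
    "op_poly v (monom 1 d) o\<^sub>L T = op_poly v p"
    using laurent_calc_poly[OF f v] by blast
  have isom: "norm (op_poly v (monom 1 d) x) = norm x" for x
    by (induction d)
      (simp_all add: monom_0 monom_Suc scalar_op_1 scalar_op_0 norm_unitary_op[OF v])
  have le: "norm (op_poly v p) \<le> B"
    using B by (intro norm_op_poly_le_sphere[OF v]) (auto simp: norm_mult norm_power simp flip: p(1))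
  then have "0 \<le> B"
    using norm_ge_zero order_trans by blast
  show ?thesis
  proof (rule norm_blinfun_bound[OF \<open>0 \<le> B\<close>])
    fix x
    have "norm (T x) = norm (op_poly v p x)"
      by (simp add: isom flip: p(2))
    also have "\<dots> \<le> norm (op_poly v p) * norm x"
      by (rule norm_blinfun)
    also have "\<dots> \<le> B * norm x"
      by (intro mult_right_mono le) simp
    finally show "norm (T x) \<le> B * norm x" .
  qed
qed

lemma laurent_calc_diff:
  assumes "laurent_calc v f S" "laurent_calc v g T"
  shows "laurent_calc v (\<lambda>z. f z - g z) (S - T)"
proof -
  have "scalar_op (- 1) o\<^sub>L T = - T"
    by (rule blinfun_eqI)
      (use scaleC_of_real[of "-1"] in \<open>simp add: scalar_op_apply blinfun.minus_left\<close>)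
  then show ?thesis
    using laurent_calc.add[OF assms(1) laurent_calc.mult[OF laurent_calc.const[of v "- 1"] assms(2)]]
    by simp
qed

text \<open>The link to the Stone-Weierstrass theorem, whose approximants are real polynomial
  functions on the plane.\<close>

lemma laurent_calc_real_polynomial:
  assumes "real_polynomial_function (g :: complex \<Rightarrow> real)"
  shows "\<exists>T. laurent_calc v (\<lambda>z. of_real (g z)) T"
  using assms
proof induction
  case (linear g)
  have g_eq: "g z = Re z * g 1 + Im z * g \<i>" for z
  proof -
    have "g (Re z *\<^sub>R 1 + Im z *\<^sub>R \<i>) = Re z * g 1 + Im z * g \<i>"
      by (simp only: linear_simps[OF linear] real_scaleR_def)
    moreover have "Re z *\<^sub>R 1 + Im z *\<^sub>R \<i> = z"
      by (simp add: complex_eq_iff)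
    ultimately show ?thesis by simp
  qed
  \<comment> \<open>A real-linear functional on the plane is a combination of z and its conjugate;
    substitute Re z = (z + cnj z)/2 and Im z = -\<i> (z - cnj z)/2.\<close>
  have g_eq': "(\<lambda>z. complex_of_real (g z)) = (\<lambda>z. (of_real (g 1) - \<i> * of_real (g \<i>)) / 2 * z
      + (of_real (g 1) + \<i> * of_real (g \<i>)) / 2 * cnj z)"
    by (rule ext, subst g_eq) (simp add: complex_eq_iff field_simps)
  have lin: "\<exists>T. laurent_calc v (\<lambda>z. a * z + b * cnj z) T" for a b
  proof -
    have 1: "laurent_calc v (\<lambda>z. a * z) (scalar_op a o\<^sub>L v)"
      by (rule laurent_calc.mult[OF laurent_calc.const laurent_calc.ident])
    have 2: "laurent_calc v (\<lambda>z. b * cnj z) (scalar_op b o\<^sub>L adj v)"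
      by (rule laurent_calc.mult[OF laurent_calc.const laurent_calc.inv])
    show ?thesis
      by (rule exI, rule laurent_calc.add[OF 1 2])
  qed
  show ?case
    by (subst g_eq') (rule lin)
next
  case (const c)
  show ?case by (rule exI[of _ "scalar_op (of_real c)"]) (rule laurent_calc.const)
next
  case (add f g)
  then obtain S T where "laurent_calc v (\<lambda>z. of_real (f z)) S" "laurent_calc v (\<lambda>z. of_real (g z)) T"
    by blast
  from laurent_calc.add[OF this] show ?case by auto
next
  case (mult f g)
  then obtain S T where "laurent_calc v (\<lambda>z. of_real (f z)) S" "laurent_calc v (\<lambda>z. of_real (g z)) T"
    by blast
  from laurent_calc.mult[OF this] show ?case by auto
qed

lemma laurent_calc_dense:
  assumes f: "continuous_on (sphere 0 1) f" and "e > 0"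
  shows "\<exists>g T. laurent_calc v g T \<and> (\<forall>z\<in>sphere 0 1. cmod (f z - g z) \<le> e)"
proof -
  obtain h where h: "polynomial_function h" "\<And>z. z \<in> sphere 0 1 \<Longrightarrow> cmod (f z - h z) < e"
    using Stone_Weierstrass_polynomial_function[OF compact_sphere f \<open>e > 0\<close>] by blast
  have "real_polynomial_function (\<lambda>z. Re (h z))" "real_polynomial_function (\<lambda>z. Im (h z))"
    using h(1) bounded_linear_Re bounded_linear_Im by (auto simp: polynomial_function_def o_def)
  then obtain S T where "laurent_calc v (\<lambda>z. of_real (Re (h z))) S" "laurent_calc v (\<lambda>z. of_real (Im (h z))) T"
    using laurent_calc_real_polynomial by metis
  from laurent_calc.add[OF this(1) laurent_calc.mult[OF laurent_calc.const[of v \<i>] this(2)]]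
  have "\<exists>T. laurent_calc v h T"
    by (simp flip: complex_eq) blast
  then show ?thesis
    using h(2) by (meson less_imp_le)
qed

section \<open>Extension to continuous functions by uniform limits\<close>

text \<open>The approximating sequence is left free, so that sums, products and adjoints of
  approximations serve as approximations again.\<close>

definition limit_calc ::
  "('a::complex_hilbert_space \<Rightarrow>\<^sub>L 'a) \<Rightarrow> (complex \<Rightarrow> complex) \<Rightarrow> ('a \<Rightarrow>\<^sub>L 'a) \<Rightarrow> bool"
  where "limit_calc v f T \<longleftrightarrow> (\<exists>g S. (\<forall>n. laurent_calc v (g n) (S n)) \<and>
    uniform_limit (sphere 0 1) g f sequentially \<and> S \<longlonglongrightarrow> T)"

text \<open>Two sequences are allowed: with \<open>g = h\<close> this yields the Cauchy property
  behind existence, with different ones the independence of the choice of sequence.\<close>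

lemma uniform_limit_norm_bound:
  assumes g: "uniform_limit X g f sequentially" and h: "uniform_limit X h f sequentially" and "e > 0"
  shows "\<exists>N. \<forall>m\<ge>N. \<forall>n\<ge>N. \<forall>z\<in>X. norm (g m z - h n z :: 'b::real_normed_vector) \<le> e"
proof -
  obtain M where M: "\<And>n z. n \<ge> M \<Longrightarrow> z \<in> X \<Longrightarrow> dist (g n z) (f z) < e / 2"
    using uniform_limitD[OF g half_gt_zero[OF \<open>e > 0\<close>]] unfolding eventually_sequentially by blast
  obtain N where N: "\<And>n z. n \<ge> N \<Longrightarrow> z \<in> X \<Longrightarrow> dist (h n z) (f z) < e / 2"
    using uniform_limitD[OF h half_gt_zero[OF \<open>e > 0\<close>]] unfolding eventually_sequentially by blast
  have "dist (g m z) (h n z) < e" if "m \<ge> max M N" "n \<ge> max M N" "z \<in> X" for m n z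
    by (rule dist_triangle_half_l[of _ "f z"]) (use that in \<open>auto intro!: M N simp del: less_divide_eq_numeral1\<close>)
  then show ?thesis
    by (metis dist_norm less_imp_le)
qed

lemma limit_calc_exists:
  fixes v :: "'a::complex_hilbert_space \<Rightarrow>\<^sub>L 'a"
  assumes v: "unitary_op v" and f: "continuous_on (sphere 0 1) f"
  shows "\<exists>T. limit_calc v f T"
proof -
  have "\<forall>n. \<exists>g T. laurent_calc v g T \<and> (\<forall>z\<in>sphere 0 1. cmod (f z - g z) \<le> inverse (real (Suc n)))"
    by (intro allI laurent_calc_dense f) simp
  then obtain g S where g: "\<And>n. laurent_calc v (g n) (S n)"
    "\<And>n z. z \<in> sphere 0 1 \<Longrightarrow> cmod (f z - g n z) \<le> inverse (real (Suc n))"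
    by metis
  have lim: "uniform_limit (sphere 0 1) g f sequentially"
  proof (rule uniform_limitI)
    fix e :: real assume "0 < e"
    with LIMSEQ_inverse_real_of_nat have "\<forall>\<^sub>F n in sequentially. inverse (Suc n) < e"
      by (rule order_tendstoD)
    then show "\<forall>\<^sub>F n in sequentially. \<forall>z\<in>sphere 0 1. dist (g n z) (f z) < e"
      by eventually_elim (metis dist_commute dist_norm g(2) le_less_trans)
  qed
  have "Cauchy S"
  proof (rule CauchyI')
    fix e :: real assume "e > 0"
    then obtain N where N: "\<And>m n z. m \<ge> N \<Longrightarrow> n \<ge> N \<Longrightarrow> z \<in> sphere 0 1 \<Longrightarrow> cmod (g m z - g n z) \<le> e / 2"
      using uniform_limit_norm_bound[OF lim lim half_gt_zero[OF \<open>e > 0\<close>]] by blast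
    have "dist (S m) (S n) \<le> e / 2" if "m \<ge> N" "n \<ge> N" for m n
      unfolding dist_norm
      by (rule norm_laurent_calc_le[OF laurent_calc_diff[OF g(1) g(1)] v]) (rule N[OF that])
    then show "\<exists>M. \<forall>m\<ge>M. \<forall>n>m. dist (S m) (S n) < e"
      using \<open>e > 0\<close> by (intro exI[of _ N] allI impI) (rule le_less_trans[of _ "e / 2"], simp_all)
  qed
  then obtain T where "S \<longlonglongrightarrow> T"
    using Cauchy_convergent_iff convergent_def by blast
  then show ?thesis
    using g(1) lim unfolding limit_calc_def by blast
qed

text \<open>Interleaving two approximations under the norm bound. Agreement on the circle alone is
  required, so this also shows that values off the circle do not matter.\<close>

lemma limit_calc_unique:
  assumes v: "unitary_op v" and "limit_calc v f S" "limit_calc v g T"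
    and eq: "\<And>z. z \<in> sphere 0 1 \<Longrightarrow> f z = g z"
  shows "S = T"
proof -
  obtain a A b B where a: "\<And>n. laurent_calc v (a n) (A n)" "uniform_limit (sphere 0 1) a f sequentially" "A \<longlonglongrightarrow> S"
    and b: "\<And>n. laurent_calc v (b n) (B n)" "uniform_limit (sphere 0 1) b g sequentially" "B \<longlonglongrightarrow> T"
    using assms unfolding limit_calc_def by metis
  have b': "uniform_limit (sphere 0 1) b f sequentially"
    using b(2) eq by (simp add: uniform_limit_iff)
  have lim: "(\<lambda>n. A n - B n) \<longlonglongrightarrow> S - T"
    by (intro tendsto_intros a b)
  have "(\<lambda>n. A n - B n) \<longlonglongrightarrow> 0"
  proof (rule LIMSEQ_I)
    fix e :: real assume "e > 0"
    then obtain N where N: "\<And>m n z. m \<ge> N \<Longrightarrow> n \<ge> N \<Longrightarrow> z \<in> sphere 0 1 \<Longrightarrow> cmod (a m z - b n z) \<le> e / 2"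
      using uniform_limit_norm_bound[OF a(2) b' half_gt_zero[OF \<open>e > 0\<close>]] by blast
    have "norm (A n - B n) \<le> e / 2" if "n \<ge> N" for n
      by (rule norm_laurent_calc_le[OF laurent_calc_diff[OF a(1) b(1)] v]) (rule N[OF that that])
    then show "\<exists>N. \<forall>n\<ge>N. norm (A n - B n - 0) < e"
      using \<open>e > 0\<close> by (intro exI[of _ N] allI impI) (rule le_less_trans[of _ "e / 2"], simp_all)
  qed
  with lim show ?thesis
    using LIMSEQ_unique by fastforce
qed

lemma limit_calc_laurent: "laurent_calc v f T \<Longrightarrow> limit_calc v f T"
  unfolding limit_calc_def
  by (intro exI[of _ "\<lambda>n. f"] exI[of _ "\<lambda>n. T"]) (simp add: uniform_limit_const)

lemma limit_calc_add: "limit_calc v f S \<Longrightarrow> limit_calc v g T \<Longrightarrow> limit_calc v (\<lambda>z. f z + g z) (S + T)"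
  unfolding limit_calc_def by (elim exE conjE) (rule exI, rule exI, rule conjI, rule allI,
      rule laurent_calc.add, blast, blast, intro conjI tendsto_add uniform_limit_add, assumption+)

text \<open>Continuity on the compact circle gives the boundedness under which uniform limits can be
  multiplied.\<close>

lemma limit_calc_mult:
  assumes "limit_calc v f S" and "limit_calc v g T"
    and "continuous_on (sphere 0 1) f" and "continuous_on (sphere 0 1) g"
  shows "limit_calc v (\<lambda>z. f z * g z) (S o\<^sub>L T)"
proof -
  obtain a A b B where a: "\<And>n. laurent_calc v (a n) (A n)" "uniform_limit (sphere 0 1) a f sequentially" "A \<longlonglongrightarrow> S"
    and b: "\<And>n. laurent_calc v (b n) (B n)" "uniform_limit (sphere 0 1) b g sequentially" "B \<longlonglongrightarrow> T"
    using assms unfolding limit_calc_def by metis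
  have bdd: "bounded (h ` sphere 0 1)" if "continuous_on (sphere 0 1) h" for h :: "complex \<Rightarrow> complex"
    by (intro compact_imp_bounded compact_continuous_image that) simp
  show ?thesis
    unfolding limit_calc_def
  proof (intro exI conjI allI)
    show "laurent_calc v (\<lambda>z. a n z * b n z) (A n o\<^sub>L B n)" for n
      by (intro laurent_calc.mult a b)
    show "uniform_limit (sphere 0 1) (\<lambda>n z. a n z * b n z) (\<lambda>z. f z * g z) sequentially"
      by (intro uniform_lim_mult a b bdd assms)
    show "(\<lambda>n. A n o\<^sub>L B n) \<longlonglongrightarrow> (S o\<^sub>L T)"
      by (intro bounded_bilinear.tendsto[OF bounded_bilinear_blinfun_compose] a b)
  qed
qed

lemma limit_calc_in_bounded_ops:
  assumes "limit_calc v f T" and v: "unitary_op v"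
  shows "T \<in> bounded_ops"
proof -
  obtain g S where "\<And>n. laurent_calc v (g n) (S n)" "S \<longlonglongrightarrow> T"
    using assms(1) unfolding limit_calc_def by blast
  then show ?thesis
    using laurent_calc_in_bounded_ops unitary_op_simps(1)[OF v] closed_bounded_ops
    by (metis closed_sequentially)
qed

lemma limit_calc_adj:
  assumes "limit_calc v f T" and v: "unitary_op v"
  shows "limit_calc v (\<lambda>z. cnj (f z)) (adj T)"
proof -
  obtain g S where g: "\<And>n. laurent_calc v (g n) (S n)" "uniform_limit (sphere 0 1) g f sequentially" "S \<longlonglongrightarrow> T"
    using assms(1) unfolding limit_calc_def by blast
  show ?thesis
    unfolding limit_calc_def
  proof (intro exI conjI allI)
    show "laurent_calc v (\<lambda>z. cnj (g n z)) (adj (S n))" for n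
      by (intro laurent_calc_adj g v)
    show "uniform_limit (sphere 0 1) (\<lambda>n z. cnj (g n z)) (\<lambda>z. cnj (f z)) sequentially"
      using g(2) by (simp add: uniform_limit_iff dist_norm flip: complex_cnj_diff)
    show "(\<lambda>n. adj (S n)) \<longlonglongrightarrow> adj T"
      by (intro tendsto_adj g laurent_calc_in_bounded_ops[OF g(1)] unitary_op_simps[OF v])
  qed
qed

section \<open>Star homomorphisms on C(S^1): norm bounds and uniqueness\<close>

definition circle_cont :: "(complex \<Rightarrow> complex) \<Rightarrow> bool"
  where "circle_cont f \<longleftrightarrow> continuous_on (sphere 0 1) f"

lemma circle_cont_intros [intro!, simp]:
  "circle_cont (\<lambda>z. c)" "circle_cont (\<lambda>z. z)"
  "circle_cont f \<Longrightarrow> circle_cont (\<lambda>z. cnj (f z))"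
  "circle_cont f \<Longrightarrow> circle_cont g \<Longrightarrow> circle_cont (\<lambda>z. f z + g z)"
  "circle_cont f \<Longrightarrow> circle_cont g \<Longrightarrow> circle_cont (\<lambda>z. f z - g z)"
  "circle_cont f \<Longrightarrow> circle_cont g \<Longrightarrow> circle_cont (\<lambda>z. f z * g z)"
  by (auto simp: circle_cont_def intro!: continuous_intros)

lemma circle_star_homD:
  assumes "circle_star_hom \<Phi>"
  shows "circle_cont f \<Longrightarrow> \<Phi> f \<in> bounded_ops"
    and "circle_cont f \<Longrightarrow> circle_cont g \<Longrightarrow> (\<And>z. z \<in> sphere 0 1 \<Longrightarrow> f z = g z) \<Longrightarrow> \<Phi> f = \<Phi> g"
    and "circle_cont f \<Longrightarrow> circle_cont g \<Longrightarrow> \<Phi> (\<lambda>z. f z + g z) = \<Phi> f + \<Phi> g"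
    and "circle_cont f \<Longrightarrow> circle_cont g \<Longrightarrow> \<Phi> (\<lambda>z. f z * g z) = \<Phi> f o\<^sub>L \<Phi> g"
    and "\<Phi> (\<lambda>z. c) = scalar_op c"
    and "circle_cont f \<Longrightarrow> \<Phi> (\<lambda>z. cnj (f z)) = adj (\<Phi> f)"
proof -
  note h = assms[unfolded circle_star_hom_def Let_def ball_simps mem_Collect_eq, folded circle_cont_def]
  show "circle_cont f \<Longrightarrow> \<Phi> f \<in> bounded_ops"
    by (rule h[THEN conjunct1, rule_format])
  show "circle_cont f \<Longrightarrow> circle_cont g \<Longrightarrow> (\<And>z. z \<in> sphere 0 1 \<Longrightarrow> f z = g z) \<Longrightarrow> \<Phi> f = \<Phi> g"
    by (rule h[THEN conjunct2, THEN conjunct1, rule_format])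
  show "circle_cont f \<Longrightarrow> circle_cont g \<Longrightarrow> \<Phi> (\<lambda>z. f z + g z) = \<Phi> f + \<Phi> g"
    by (rule h[THEN conjunct2, THEN conjunct2, THEN conjunct1, rule_format])
  show "circle_cont f \<Longrightarrow> circle_cont g \<Longrightarrow> \<Phi> (\<lambda>z. f z * g z) = \<Phi> f o\<^sub>L \<Phi> g"
    by (rule h[THEN conjunct2, THEN conjunct2, THEN conjunct2, THEN conjunct1, rule_format])
  show "\<Phi> (\<lambda>z. c) = scalar_op c" "circle_cont f \<Longrightarrow> \<Phi> (\<lambda>z. cnj (f z)) = adj (\<Phi> f)"
    using h[THEN conjunct2, THEN conjunct2, THEN conjunct2, THEN conjunct2] by auto
qed

lemma circle_star_homI:
  assumes "\<And>f. circle_cont f \<Longrightarrow> \<Phi> f \<in> bounded_ops"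
    and "\<And>f g. circle_cont f \<Longrightarrow> circle_cont g \<Longrightarrow> (\<And>z. z \<in> sphere 0 1 \<Longrightarrow> f z = g z) \<Longrightarrow> \<Phi> f = \<Phi> g"
    and "\<And>f g. circle_cont f \<Longrightarrow> circle_cont g \<Longrightarrow> \<Phi> (\<lambda>z. f z + g z) = \<Phi> f + \<Phi> g"
    and "\<And>f g. circle_cont f \<Longrightarrow> circle_cont g \<Longrightarrow> \<Phi> (\<lambda>z. f z * g z) = \<Phi> f o\<^sub>L \<Phi> g"
    and "\<And>c. \<Phi> (\<lambda>z. c) = scalar_op c"
    and "\<And>f. circle_cont f \<Longrightarrow> \<Phi> (\<lambda>z. cnj (f z)) = adj (\<Phi> f)"
  shows "circle_star_hom \<Phi>"
proof -
  have "Collect (continuous_on (sphere 0 1)) = Collect circle_cont"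
    by (auto simp: circle_cont_def)
  then show ?thesis
    unfolding circle_star_hom_def Let_def by (auto intro: assms(1-4,6)) (simp add: assms(5))
qed

lemma circle_star_hom_diff:
  assumes "circle_star_hom \<Phi>" "circle_cont f" "circle_cont g"
  shows "\<Phi> (\<lambda>z. f z - g z) = \<Phi> f - \<Phi> g"
  using circle_star_homD(3)[OF assms(1), of "\<lambda>z. f z - g z" g] assms by simp

text \<open>If \<open>\<bar>f\<bar> \<le> \<bar>g\<bar>\<close> then \<open>\<bar>g\<bar>\<^sup>2 - \<bar>f\<bar>\<^sup>2\<close> is the square of a real continuous function.\<close>

lemma circle_star_hom_norm_le:
  assumes \<Phi>: "circle_star_hom \<Phi>" and f: "circle_cont f" and g: "circle_cont g"
    and le: "\<And>z. z \<in> sphere 0 1 \<Longrightarrow> cmod (f z) \<le> cmod (g z)"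
  shows "norm (\<Phi> f x) \<le> norm (\<Phi> g x)"
proof -
  have sq: "cinner x (\<Phi> (\<lambda>z. cnj (h z) * h z) x) = of_real ((norm (\<Phi> h x))\<^sup>2)" if "circle_cont h" for h
  proof -
    have "\<Phi> (\<lambda>z. cnj (h z) * h z) = adj (\<Phi> h) o\<^sub>L \<Phi> h"
      using that by (simp add: circle_star_homD(4,6)[OF \<Phi>])
    then show ?thesis
      using that by (simp add: circle_star_homD(1)[OF \<Phi>] cinner_self flip: cinner_adj)
  qed
  define q where "q z = complex_of_real (sqrt ((cmod (g z))\<^sup>2 - (cmod (f z))\<^sup>2))" for z
  have q: "circle_cont q"
    using f g unfolding q_def circle_cont_def by (intro continuous_intros)
  have "cnj (g z) * g z = cnj (f z) * f z + cnj (q z) * q z" if "z \<in> sphere 0 1" for z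
  proof -
    have "cnj (q z) * q z = of_real ((cmod (g z))\<^sup>2 - (cmod (f z))\<^sup>2)"
      using le[OF that] by (simp add: q_def power_mono flip: of_real_mult)
    then show ?thesis
      unfolding of_real_diff complex_norm_square by (simp only: mult.commute[of "cnj _"]) simp
  qed
  then have "\<Phi> (\<lambda>z. cnj (g z) * g z) = \<Phi> (\<lambda>z. cnj (f z) * f z + cnj (q z) * q z)"
    using f g q by (intro circle_star_homD(2)[OF \<Phi>]) auto
  also have "\<dots> = \<Phi> (\<lambda>z. cnj (f z) * f z) + \<Phi> (\<lambda>z. cnj (q z) * q z)"
    using f q by (intro circle_star_homD(3)[OF \<Phi>]) auto
  finally have "complex_of_real ((norm (\<Phi> g x))\<^sup>2) = of_real ((norm (\<Phi> f x))\<^sup>2) + of_real ((norm (\<Phi> q x))\<^sup>2)"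
    using f g q by (simp only: blinfun.add_left cinner_add_right flip: sq)
  then have "(norm (\<Phi> g x))\<^sup>2 = (norm (\<Phi> f x))\<^sup>2 + (norm (\<Phi> q x))\<^sup>2"
    by (simp only: of_real_eq_iff flip: of_real_add)
  then have "(norm (\<Phi> f x))\<^sup>2 \<le> (norm (\<Phi> g x))\<^sup>2"
    by simp
  then show ?thesis
    by (rule power2_le_imp_le) simp
qed

lemma circle_star_hom_norm_le_const:
  assumes \<Phi>: "circle_star_hom \<Phi>" and f: "circle_cont f" and "e \<ge> 0"
    and le: "\<And>z. z \<in> sphere 0 1 \<Longrightarrow> cmod (f z) \<le> e"
  shows "norm (\<Phi> f) \<le> e"
proof (rule norm_blinfun_bound[OF \<open>e \<ge> 0\<close>])
  fix x
  have "norm (\<Phi> f x) \<le> norm (\<Phi> (\<lambda>z. of_real e) x)"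
    using le \<open>e \<ge> 0\<close> by (intro circle_star_hom_norm_le[OF \<Phi> f]) auto
  then show "norm (\<Phi> f x) \<le> e * norm x"
    using \<open>e \<ge> 0\<close> by (simp add: circle_star_homD(5)[OF \<Phi>] scalar_op_apply norm_scaleC)
qed

lemma circle_star_hom_laurent:
  assumes "laurent_calc v f T" and \<Phi>: "circle_star_hom \<Phi>" and v: "\<Phi> (\<lambda>z. z) = v"
  shows "\<Phi> f = T"
  using assms(1)
proof induction
  case inv
  show ?case
    using circle_star_homD(6)[OF \<Phi>, of "\<lambda>z. z"] v by simp
next
  case (add f S g T)
  then show ?case
    using laurent_calc_continuous by (subst circle_star_homD(3)[OF \<Phi>]) (auto simp: circle_cont_def)
next
  case (mult f S g T)
  then show ?case
    using laurent_calc_continuous by (subst circle_star_homD(4)[OF \<Phi>]) (auto simp: circle_cont_def)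
qed (simp_all add: v circle_star_homD(5)[OF \<Phi>])

lemma circle_star_hom_limit:
  assumes \<Phi>: "circle_star_hom \<Phi>" and v: "\<Phi> (\<lambda>z. z) = v" and f: "circle_cont f"
  shows "\<exists>g S. (\<forall>n. laurent_calc v (g n) (S n)) \<and> S \<longlonglongrightarrow> \<Phi> f"
proof -
  have "\<forall>n. \<exists>g T. laurent_calc v g T \<and> (\<forall>z\<in>sphere 0 1. cmod (f z - g z) \<le> inverse (real (Suc n)))"
    using f by (intro allI laurent_calc_dense) (simp_all add: circle_cont_def)
  then obtain g S where g: "\<And>n. laurent_calc v (g n) (S n)"
    "\<And>n z. z \<in> sphere 0 1 \<Longrightarrow> cmod (f z - g n z) \<le> inverse (real (Suc n))"
    by metis
  have "norm (S n - \<Phi> f) \<le> inverse (real (Suc n))" for n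
  proof -
    have gc: "circle_cont (g n)"
      using laurent_calc_continuous[OF g(1)] by (simp add: circle_cont_def)
    have "norm (\<Phi> (\<lambda>z. f z - g n z)) \<le> inverse (real (Suc n))"
      using f gc g(2) by (intro circle_star_hom_norm_le_const[OF \<Phi>]) simp_all
    then show ?thesis
      using circle_star_hom_diff[OF \<Phi> f gc] circle_star_hom_laurent[OF g(1) \<Phi> v]
      by (simp add: norm_minus_commute)
  qed
  then have "(\<lambda>n. S n - \<Phi> f) \<longlonglongrightarrow> 0"
    by (intro Lim_null_comparison[OF _ LIMSEQ_inverse_real_of_nat]) simp
  then show ?thesis
    using g(1) LIM_zero_cancel by blast
qed

text \<open>Each value is a norm limit of Laurent polynomials in the image of the identity function,
  and these stay in any closed star algebra containing that image and 1.\<close>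

lemma circle_star_hom_in_cstar_subalgebra:
  assumes "circle_star_hom \<Phi>" and "circle_cont f"
    and "cstar_subalgebra A" and "\<Phi> (\<lambda>z. z) \<in> A" and "id_blinfun \<in> A"
  shows "\<Phi> f \<in> A"
  using circle_star_hom_limit[OF assms(1) refl assms(2)] assms(3-5)
    laurent_calc_in_star_subalgebra closed_sequentially
  unfolding cstar_subalgebra_def by metis

text \<open>Both values are within e/2 of the same Laurent operator. Besides settling the
  description in \<open>fun_calc\<close>, this later identifies the calculus conjugated by
  \<open>u\<close> with the rotated one.\<close>

lemma circle_star_hom_unique:
  fixes \<Phi> \<Psi> :: "(complex \<Rightarrow> complex) \<Rightarrow> 'a::complex_hilbert_space \<Rightarrow>\<^sub>L 'a"
  assumes \<Phi>: "circle_star_hom \<Phi>" and \<Psi>: "circle_star_hom \<Psi>" and eq: "\<Phi> (\<lambda>z. z) = \<Psi> (\<lambda>z. z)"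
    and f: "circle_cont f"
  shows "\<Phi> f = \<Psi> f"
proof -
  have "norm (\<Phi> f - \<Psi> f) \<le> e" if "e > 0" for e
  proof -
    obtain g T where g: "laurent_calc (\<Phi> (\<lambda>z. z)) g T" "\<And>z. z \<in> sphere 0 1 \<Longrightarrow> cmod (f z - g z) \<le> e / 2"
      using laurent_calc_dense[OF f[unfolded circle_cont_def] half_gt_zero[OF \<open>e > 0\<close>]] by blast
    have gc: "circle_cont g"
      using laurent_calc_continuous[OF g(1)] by (simp add: circle_cont_def)
    have diff: "norm (\<Theta> (\<lambda>z. f z - g z)) \<le> e / 2" if "circle_star_hom \<Theta>" for \<Theta> :: "_ \<Rightarrow> 'a \<Rightarrow>\<^sub>L 'a"
      using f gc \<open>e > 0\<close> by (intro circle_star_hom_norm_le_const[OF that _ _ g(2)]) simp_all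
    from diff[OF \<Phi>] diff[OF \<Psi>] have "norm (\<Phi> f - T) \<le> e / 2" "norm (\<Psi> f - T) \<le> e / 2"
      using circle_star_hom_laurent[OF g(1) \<Phi>] circle_star_hom_laurent[OF g(1) \<Psi>] eq
      by (simp_all add: circle_star_hom_diff \<Phi> \<Psi> f gc)
    then show ?thesis
      using norm_triangle_ineq4[of "\<Phi> f - T" "\<Psi> f - T"] by simp
  qed
  then have "norm (\<Phi> f - \<Psi> f) \<le> 0"
    by (rule dense_ge)
  then show ?thesis
    by simp
qed

theorem fun_calc_circle_star_hom:
  fixes v :: "'a::complex_hilbert_space \<Rightarrow>\<^sub>L 'a"
  assumes v: "unitary_op v"
  shows "circle_star_hom (fun_calc v)" and "fun_calc v (\<lambda>z. z) = v"
proof -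
  define \<Phi> where "\<Phi> f = (THE T. limit_calc v f T)" for f
  have \<Phi>_eqI: "\<Phi> f = T" if "limit_calc v f T" for f T
    unfolding \<Phi>_def using that limit_calc_unique[OF v] by blast
  have \<Phi>_calc: "limit_calc v f (\<Phi> f)" if "continuous_on (sphere 0 1) f" for f
    using limit_calc_exists[OF v that] \<Phi>_eqI by blast
  have hom: "circle_star_hom \<Phi>"
  proof (rule circle_star_homI)
    show "\<Phi> f = \<Phi> g" if "circle_cont f" "circle_cont g" "\<And>z. z \<in> sphere 0 1 \<Longrightarrow> f z = g z" for f g
      by (rule limit_calc_unique[OF v \<Phi>_calc \<Phi>_calc]) (use that in \<open>simp_all only: circle_cont_def\<close>)
    show "\<Phi> (\<lambda>z. c) = scalar_op c" for c
      by (intro \<Phi>_eqI limit_calc_laurent laurent_calc.const)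
  qed (auto intro!: \<Phi>_eqI limit_calc_add limit_calc_mult limit_calc_adj limit_calc_in_bounded_ops
      \<Phi>_calc v simp: circle_cont_def)
  have \<Phi>_id: "\<Phi> (\<lambda>z. z) = v"
    by (intro \<Phi>_eqI limit_calc_laurent laurent_calc.ident)
  \<comment> \<open>Restricted to continuous functions: elsewhere a star homomorphism is
    unconstrained, apart from the constants, and the description need not be unique.\<close>
  have eq: "fun_calc v f = \<Phi> f" if "circle_cont f" for f
    unfolding fun_calc_def
  proof (rule the_equality)
    show "\<exists>\<Psi>. circle_star_hom \<Psi> \<and> \<Psi> (\<lambda>z. z) = v \<and> \<Psi> f = \<Phi> f"
      using hom \<Phi>_id by blast
    show "T = \<Phi> f" if ex: "\<exists>\<Psi>. circle_star_hom \<Psi> \<and> \<Psi> (\<lambda>z. z) = v \<and> \<Psi> f = T" for T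
    proof -
      obtain \<Psi> where "circle_star_hom \<Psi>" "\<Psi> (\<lambda>z. z) = v" "\<Psi> f = T"
        using ex by blast
      then show ?thesis
        using circle_star_hom_unique[OF _ hom _ \<open>circle_cont f\<close>] \<Phi>_id by auto
    qed
  qed
  then show "fun_calc v (\<lambda>z. z) = v"
    by (simp add: \<Phi>_id)
  show "circle_star_hom (fun_calc v)"
  proof (rule circle_star_homI)
    show "fun_calc v f = fun_calc v g"
      if "circle_cont f" "circle_cont g" "\<And>z. z \<in> sphere 0 1 \<Longrightarrow> f z = g z" for f g
      unfolding eq[OF that(1)] eq[OF that(2)] by (rule circle_star_homD(2)[OF hom that])
  qed (simp_all add: eq circle_star_homD(1,3-6)[OF hom])
qed

section \<open>Generated algebras\<close>

lemma cstar_subalgebraD: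
  assumes "cstar_subalgebra A"
  shows "A \<subseteq> bounded_ops" "0 \<in> A" "closed A"
    and "a \<in> A \<Longrightarrow> b \<in> A \<Longrightarrow> a + b \<in> A"
    and "a \<in> A \<Longrightarrow> scalar_op c o\<^sub>L a \<in> A"
    and "a \<in> A \<Longrightarrow> b \<in> A \<Longrightarrow> a o\<^sub>L b \<in> A"
    and "a \<in> A \<Longrightarrow> adj a \<in> A"
  using assms by (simp_all add: cstar_subalgebra_def star_subalgebra_def)

lemma cstar_generated_inc: "x \<in> S \<Longrightarrow> x \<in> cstar_generated S"
  by (auto simp: cstar_generated_def)

lemma cstar_generated_least: "cstar_subalgebra A \<Longrightarrow> S \<subseteq> A \<Longrightarrow> cstar_generated S \<subseteq> A"
  by (auto simp: cstar_generated_def)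

lemma cstar_subalgebra_bounded_ops: "cstar_subalgebra bounded_ops"
  by (simp add: cstar_subalgebra_def star_subalgebra_bounded_ops closed_bounded_ops)

text \<open>The assumption on \<open>S\<close> puts \<open>bounded_ops\<close> into the family being
  intersected; an empty family would have \<open>UNIV\<close> as its intersection.\<close>

lemma cstar_subalgebra_generated:
  assumes "S \<subseteq> bounded_ops"
  shows "cstar_subalgebra (cstar_generated S)"
  unfolding cstar_subalgebra_def star_subalgebra_def
proof (intro conjI ballI allI)
  show "cstar_generated S \<subseteq> bounded_ops"
    by (rule cstar_generated_least[OF cstar_subalgebra_bounded_ops assms])
  show "closed (cstar_generated S)"
    unfolding cstar_generated_def by (intro closed_Inter ballI) (simp add: cstar_subalgebraD)
qed (auto simp: cstar_generated_def cstar_subalgebraD)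

section \<open>Irrational rotations\<close>

text \<open>Density of the fractional parts of k \<theta> with positive k. The sign matters: it
  gives density of the forward half-orbit and not merely of the full orbit.\<close>

lemma irrational_rotation_dense:
  assumes "\<theta> \<notin> \<rat>" and "z \<in> sphere 0 1" and "e > 0"
  shows "\<exists>n. cmod (cis (2 * pi * \<theta>) ^ n - z) < e"
proof -
  obtain t where t: "z = cis t"
  proof
    show "z = cis (Arg z)"
      using assms(2) cis_Arg[of z] by (cases "z = 0") (simp_all add: sgn_eq)
  qed
  have "isCont cis t"
    unfolding cis_conv_exp by (intro continuous_intros)
  then obtain d where d: "d > 0" "\<And>x. dist x t < d \<Longrightarrow> dist (cis x) (cis t) < e"
    using \<open>e > 0\<close> unfolding continuous_at_eps_delta by blast
  obtain h k :: int where k: "k > 0" "\<bar>of_int k * \<theta> - of_int h - t / (2 * pi)\<bar> < d / (2 * pi)"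
  proof (rule sequence_of_fractional_parts_is_dense[OF assms(1)])
    show "0 < d / (2 * pi)"
      using d(1) by simp
  qed
  define n where "n = nat k"
  have n: "of_int k = real n"
    using k(1) by (simp add: n_def)
  have "\<bar>2 * pi * (real n * \<theta> - of_int h) - t\<bar> = 2 * pi * \<bar>real n * \<theta> - of_int h - t / (2 * pi)\<bar>"
    using pi_gt_zero by (simp add: abs_if field_simps)
  also have "\<dots> < d"
    using k(2) pi_gt_zero by (simp add: n field_simps)
  finally have "dist (2 * pi * (real n * \<theta> - of_int h)) t < d"
    by (simp add: dist_real_def)
  then have "dist (cis (2 * pi * (real n * \<theta> - of_int h))) z < e"
    using d(2) t by simp
  moreover have "cis (2 * pi * (real n * \<theta> - of_int h)) = cis (2 * pi * \<theta>) ^ n"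
  proof -
    have "cis (2 * pi * (real n * \<theta> - of_int h)) = cis (real n * (2 * pi * \<theta>)) / cis (2 * pi * of_int h)"
      by (simp add: cis_divide algebra_simps)
    also have "cis (2 * pi * of_int h) = 1"
      by (rule cis_multiple_2pi) simp
    finally show ?thesis
      by (simp add: Complex.DeMoivre)
  qed
  ultimately show ?thesis
    by (auto simp: dist_norm)
qed

lemma continuous_zero_on_rotation_orbit:
  fixes c :: "complex \<Rightarrow> 'b::real_normed_vector"
  assumes "\<theta> \<notin> \<rat>" and c: "continuous_on (sphere 0 1) c"
    and zero: "\<And>n. c (cis (2 * pi * \<theta>) ^ n) = 0" and z: "z \<in> sphere 0 1"
  shows "c z = 0"
proof (rule ccontr)
  assume "c z \<noteq> 0"
  then obtain d where d: "d > 0" "\<And>w. w \<in> sphere 0 1 \<Longrightarrow> dist w z < d \<Longrightarrow> dist (c w) (c z) < norm (c z)"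
    using c[unfolded continuous_on_iff, rule_format, OF z, of "norm (c z)"] by auto
  obtain n where n: "cmod (cis (2 * pi * \<theta>) ^ n - z) < d"
    using irrational_rotation_dense[OF assms(1) z d(1)] by blast
  have "dist (c (cis (2 * pi * \<theta>) ^ n)) (c z) < norm (c z)"
    using n by (intro d) (simp_all add: dist_norm norm_power)
  then show False
    by (simp add: zero dist_norm)
qed

lemma circle_cont_rotate:
  assumes "cmod c = 1" and "circle_cont f"
  shows "circle_cont (\<lambda>z. f (c * z))"
  unfolding circle_cont_def
proof (rule continuous_on_compose2[of "sphere 0 1" f])
  show "continuous_on (sphere 0 1) f"
    using assms(2) by (simp add: circle_cont_def)
qed (use assms(1) in \<open>auto simp: norm_mult intro!: continuous_intros\<close>)

lemma circle_cont_of_real: "continuous_on (sphere 0 1) f \<Longrightarrow> circle_cont (\<lambda>z. complex_of_real (f z))"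
  unfolding circle_cont_def by (intro continuous_intros)

section \<open>Rotation by conjugation, faithfulness and approximate eigenvectors\<close>

text \<open>\<open>nontrivial\<close> excludes the zero space, where the relations hold but every
  f(v) is 0.\<close>

locale irrational_rotation =
  fixes u v :: "'a::complex_hilbert_space \<Rightarrow>\<^sub>L 'a" and \<theta> :: real and q :: complex
  assumes unitary_u: "unitary_op u" and unitary_v: "unitary_op v"
    and irrational: "\<theta> \<notin> \<rat>" and q_def: "q = cis (2 * pi * \<theta>)"
    and commutation: "v o\<^sub>L u = scalar_op q o\<^sub>L (u o\<^sub>L v)"
    and nontrivial: "(id_blinfun :: 'a \<Rightarrow>\<^sub>L 'a) \<noteq> 0"
begin

lemmas hom = fun_calc_circle_star_hom(1)[OF unitary_v]
lemmas u_simps = unitary_op_simps[OF unitary_u]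
lemmas v_simps = unitary_op_simps[OF unitary_v]

lemma norm_q: "cmod q = 1" "cmod (cnj q) = 1"
  by (simp_all add: q_def)

lemma q_cnj: "q * cnj q = 1" "cnj q * q = 1"
  by (simp_all add: q_def cis_cnj cis_mult)

lemma q_power_neq_1:
  assumes "n > 0"
  shows "q ^ n \<noteq> 1"
proof
  assume "q ^ n = 1"
  moreover have "q ^ n = cis (2 * pi * (real n * \<theta>))"
    unfolding q_def Complex.DeMoivre by (simp add: algebra_simps)
  ultimately have "cos (2 * pi * (real n * \<theta>)) = 1"
    by (simp add: complex_eq_iff)
  then obtain m :: int where "2 * pi * (real n * \<theta>) = 2 * pi * of_int m"
    by (auto simp: cos_one_2pi_int mult_ac)
  then have "\<theta> = of_int m / of_nat n"
    using assms by (simp add: field_simps)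
  then show False
    using irrational by simp
qed

text \<open>The backward half-orbit is the forward one for - \<theta>, so either half determines a
  continuous function.\<close>

lemma zero_if_zero_on_orbit:
  fixes c :: "complex \<Rightarrow> 'b::real_normed_vector"
  assumes "continuous_on (sphere 0 1) c"
    and "(\<forall>n. c (q ^ n) = 0) \<or> (\<forall>n. c (cnj q ^ n) = 0)" and "z \<in> sphere 0 1"
  shows "c z = 0"
proof -
  have "cnj q = cis (2 * pi * (- \<theta>))" "- \<theta> \<notin> \<rat>"
    using irrational by (simp_all add: q_def cis_cnj)
  then show ?thesis
    using assms irrational continuous_zero_on_rotation_orbit q_def by metis
qed

text \<open>The right-hand side is itself a unital star homomorphism in f, and the commutation
  relation makes it send the identity function to \<open>v\<close>; uniqueness does the
  rest.\<close>

lemma fun_calc_conj: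
  assumes f: "circle_cont f"
  shows "fun_calc v f = u o\<^sub>L fun_calc v (\<lambda>z. f (q * z)) o\<^sub>L adj u"
proof -
  define \<Phi> where "\<Phi> f = u o\<^sub>L fun_calc v (\<lambda>z. f (q * z)) o\<^sub>L adj u" for f
  note rot = circle_cont_rotate[OF norm_q(1)]
  have bo: "fun_calc v (\<lambda>z. f (q * z)) \<in> bounded_ops" if "circle_cont f" for f
    using that by (intro circle_star_homD(1)[OF hom] rot)
  have \<Phi>: "circle_star_hom \<Phi>"
  proof (rule circle_star_homI)
    fix f g assume f: "circle_cont f"
    show "\<Phi> f \<in> bounded_ops"
      unfolding \<Phi>_def by (intro compose_in_bounded_ops u_simps bo f)
    have "adj (\<Phi> f) = u o\<^sub>L (adj (fun_calc v (\<lambda>z. f (q * z))) o\<^sub>L adj u)"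
      by (simp add: \<Phi>_def adj_compose compose_in_bounded_ops u_simps bo f adj_adj)
    also have "\<dots> = \<Phi> (\<lambda>z. cnj (f z))"
      unfolding \<Phi>_def by (subst circle_star_homD(6)[OF hom rot[OF f], symmetric]) (rule blinfun_eqI, simp)
    finally show "\<Phi> (\<lambda>z. cnj (f z)) = adj (\<Phi> f)" ..
    assume g: "circle_cont g"
    show "\<Phi> (\<lambda>z. f z + g z) = \<Phi> f + \<Phi> g"
      unfolding \<Phi>_def circle_star_homD(3)[OF hom rot[OF f] rot[OF g]]
      by (rule blinfun_eqI) (simp add: blinfun.add_left blinfun.add_right)
    show "\<Phi> (\<lambda>z. f z * g z) = \<Phi> f o\<^sub>L \<Phi> g"
      unfolding \<Phi>_def circle_star_homD(4)[OF hom rot[OF f] rot[OF g]]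
      by (rule blinfun_eqI) (simp add: u_simps)
    assume eq: "\<And>z. z \<in> sphere 0 1 \<Longrightarrow> f z = g z"
    have "fun_calc v (\<lambda>z. f (q * z)) = fun_calc v (\<lambda>z. g (q * z))"
      by (rule circle_star_homD(2)[OF hom rot[OF f] rot[OF g]]) (simp add: eq norm_mult norm_q)
    then show "\<Phi> f = \<Phi> g"
      by (simp add: \<Phi>_def)
  next
    show "\<Phi> (\<lambda>z. c) = scalar_op c" for c
      unfolding \<Phi>_def circle_star_homD(5)[OF hom]
      by (rule blinfun_eqI) (simp add: scalar_op_apply bounded_ops_scaleC u_simps)
  qed
  have \<Phi>_id: "\<Phi> (\<lambda>z. z) = v"
  proof -
    have "\<Phi> (\<lambda>z. z) = u o\<^sub>L (scalar_op q o\<^sub>L v) o\<^sub>L adj u"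
      unfolding \<Phi>_def
      using circle_star_homD(4)[OF hom, of "\<lambda>z. q" "\<lambda>z. z"]
      by (simp add: circle_star_homD(5)[OF hom] fun_calc_circle_star_hom(2)[OF unitary_v])
    also have "\<dots> = v o\<^sub>L u o\<^sub>L adj u"
      unfolding commutation by (rule blinfun_eqI) (simp add: scalar_op_apply bounded_ops_scaleC u_simps)
    also have "\<dots> = v"
      by (rule blinfun_eqI) (simp add: u_simps)
    finally show ?thesis .
  qed
  have "\<Phi> f = fun_calc v f"
    by (rule circle_star_hom_unique[OF \<Phi> hom _ f])
      (simp add: \<Phi>_id fun_calc_circle_star_hom(2)[OF unitary_v])
  then show ?thesis by (simp add: \<Phi>_def)
qed

lemma fun_calc_u: "circle_cont f \<Longrightarrow> fun_calc v f (u x) = u (fun_calc v (\<lambda>z. f (q * z)) x)"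
  by (subst fun_calc_conj) (simp_all add: u_simps)

lemma fun_calc_u_power:
  "circle_cont f \<Longrightarrow> fun_calc v f ((blinfun_apply u ^^ n) x) = (blinfun_apply u ^^ n) (fun_calc v (\<lambda>z. f (q ^ n * z)) x)"
proof (induction n arbitrary: f)
  case (Suc n)
  then show ?case
    using Suc.IH[OF circle_cont_rotate[OF norm_q(1) Suc.prems]]
    by (simp add: fun_calc_u mult_ac)
qed simp

lemma norm_u_power: "norm ((blinfun_apply u ^^ n) x) = norm x"
  by (induction n) (simp_all add: norm_unitary_op[OF unitary_u])

lemma fun_calc_eq_0_imp_rotate:
  assumes f: "circle_cont f" and "fun_calc v f = 0"
  shows "fun_calc v (\<lambda>z. f (q ^ n * z)) = 0"
proof (rule blinfun_eqI)
  fix x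
  have "norm ((blinfun_apply u ^^ n) (fun_calc v (\<lambda>z. f (q ^ n * z)) x)) = 0"
    using fun_calc_u_power[OF f, of n x] assms(2) by simp
  then show "fun_calc v (\<lambda>z. f (q ^ n * z)) x = blinfun_apply 0 x"
    by (simp add: norm_u_power)
qed

text \<open>Faithfulness of the calculus. Its kernel is a rotation-invariant ideal. If f(v) = 0 but
  f is not zero, the rotations of f have no common zero, since f would vanish along a dense orbit.
  By compactness finitely many suffice, and the sum of their squared moduli is invertible and still
  in the kernel, so 1 = 0.\<close>

lemma fun_calc_eq_0D:
  assumes f: "circle_cont f" and zero: "fun_calc v f = 0" and z: "z \<in> sphere 0 1"
  shows "f z = 0"
proof (rule ccontr)
  assume "f z \<noteq> 0"
  have rot: "circle_cont (\<lambda>z. f (q ^ n * z))" for n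
    by (intro circle_cont_rotate f) (simp add: norm_power norm_q)
  define F where "F n = {w \<in> sphere 0 1. f (q ^ n * w) = 0}" for n
  have "closed (F n)" for n
  proof -
    have "F n = sphere 0 1 \<inter> (\<lambda>w. f (q ^ n * w)) -` {0}"
      by (auto simp: F_def)
    then show ?thesis
      using continuous_closed_preimage[of "sphere 0 1" "\<lambda>w. f (q ^ n * w)" "{0}"] rot[of n]
      by (simp add: circle_cont_def)
  qed
  moreover have "sphere 0 1 \<inter> (\<Inter>n\<in>UNIV. F n) = {}"
  proof (rule ccontr)
    assume "sphere 0 1 \<inter> (\<Inter>n\<in>UNIV. F n) \<noteq> {}"
    then obtain w where w: "cmod w = 1" "\<And>n. f (q ^ n * w) = 0"
      by (auto simp: F_def)
    \<comment> \<open>Multiplication by \<open>w\<close> carries the orbit of 1 to that of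
      \<open>w\<close>; the value at \<zeta> = z * cnj w is f z.\<close>
    have "f ((z * cnj w) * w) = 0"
    proof (rule zero_if_zero_on_orbit[where c = "\<lambda>\<zeta>. f (\<zeta> * w)"])
      show "continuous_on (sphere 0 1) (\<lambda>\<zeta>. f (\<zeta> * w))"
        using circle_cont_rotate[OF w(1) f] by (simp add: circle_cont_def mult.commute)
    qed (use w z in \<open>simp_all add: norm_mult\<close>)
    moreover have "(z * cnj w) * w = z"
      using w(1) complex_norm_square[of w] by (simp add: mult.assoc mult.commute[of "cnj w"])
    ultimately show False
      using \<open>f z \<noteq> 0\<close> by simp
  qed
  ultimately have "\<exists>I. finite I \<and> sphere 0 1 \<inter> (\<Inter>n\<in>I. F n) = {}"
    using compact_imp_fip_image[of "sphere (0::complex) 1" UNIV F] by auto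
  then obtain I where I: "finite I" "\<And>w. w \<in> sphere 0 1 \<Longrightarrow> \<exists>n\<in>I. f (q ^ n * w) \<noteq> 0"
    by (fastforce simp: F_def)
  define h where "h w = (\<Sum>n\<in>I. f (q ^ n * w) * cnj (f (q ^ n * w)))" for w
  have "circle_cont (\<lambda>w. \<Sum>n\<in>I. f (q ^ n * w) * cnj (f (q ^ n * w))) \<and>
      fun_calc v (\<lambda>w. \<Sum>n\<in>I. f (q ^ n * w) * cnj (f (q ^ n * w))) = 0"
    using I(1)
  proof induction
    case empty
    show ?case by (simp add: circle_star_homD(5)[OF hom] scalar_op_0)
  next
    case (insert n I)
    then show ?case
      by (simp add: rot circle_star_homD(3,4)[OF hom] fun_calc_eq_0_imp_rotate[OF f zero])
  qed
  then have h: "circle_cont h" "fun_calc v h = 0"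
    unfolding h_def by simp_all
  have h_nz: "h w \<noteq> 0" if w: "w \<in> sphere 0 1" for w
  proof -
    have "h w = of_real (\<Sum>n\<in>I. (cmod (f (q ^ n * w)))\<^sup>2)"
      by (simp only: h_def of_real_sum complex_norm_square)
    moreover have "(\<Sum>n\<in>I. (cmod (f (q ^ n * w)))\<^sup>2) \<noteq> 0"
      using I(2)[OF w] by (simp add: sum_nonneg_eq_0_iff[OF I(1)])
    ultimately show ?thesis
      by (simp only: of_real_eq_0_iff not_False_eq_True)
  qed
  have inv: "circle_cont (\<lambda>w. inverse (h w))"
    using h(1) h_nz by (auto simp: circle_cont_def intro!: continuous_intros)
  have "fun_calc v (\<lambda>w. 1) = fun_calc v (\<lambda>w. h w * inverse (h w))"
    by (rule circle_star_homD(2)[OF hom]) (use h inv h_nz in auto)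
  also have "\<dots> = 0"
    using h inv by (simp add: circle_star_homD(4)[OF hom])
  finally show False
    using nontrivial by (simp add: circle_star_homD(5)[OF hom] scalar_op_1)
qed

text \<open>Unit vectors in the ranges of k(v), for bumps k shrinking to \<open>z0\<close>;
  faithfulness makes these ranges non-zero. A single sequence works for all h
  simultaneously.\<close>

lemma approximate_eigenvectors:
  assumes z0: "z0 \<in> sphere 0 1"
  shows "\<exists>\<xi> :: nat \<Rightarrow> 'a. (\<forall>t. norm (\<xi> t) = 1) \<and>
    (\<forall>h. circle_cont h \<longrightarrow> (\<lambda>t. fun_calc v h (\<xi> t) - h z0 *\<^sub>C \<xi> t) \<longlonglongrightarrow> 0)"
proof -
  \<comment> \<open>A tent of height 1 at \<open>z0\<close>, vanishing at distance 1/(t+1) and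
    beyond.\<close>
  define k where "k t z = complex_of_real (max 0 (1 - real (Suc t) * cmod (z - z0)))" for t z
  have k: "circle_cont (k t)" for t
    unfolding k_def by (intro circle_cont_of_real continuous_intros)
  have "\<exists>\<eta>. fun_calc v (k t) \<eta> \<noteq> 0" for t
  proof -
    have "fun_calc v (k t) \<noteq> 0"
      using fun_calc_eq_0D[OF k _ z0, of t] by (auto simp: k_def)
    then show ?thesis
      by (metis blinfun_eqI zero_blinfun.rep_eq)
  qed
  then obtain \<eta> where \<eta>: "\<And>t. fun_calc v (k t) (\<eta> t) \<noteq> 0"
    by metis
  define r where "r t = inverse (norm (fun_calc v (k t) (\<eta> t)))" for t
  define \<xi> where "\<xi> t = r t *\<^sub>R fun_calc v (k t) (\<eta> t)" for t
  have "(\<lambda>t. fun_calc v h (\<xi> t) - h z0 *\<^sub>C \<xi> t) \<longlonglongrightarrow> 0" if h: "circle_cont h" for h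
  proof (rule LIMSEQ_I)
    fix e :: real assume "e > 0"
    obtain d where d: "d > 0" "\<And>z. z \<in> sphere 0 1 \<Longrightarrow> dist z z0 < d \<Longrightarrow> dist (h z) (h z0) < e / 2"
      using h[unfolded circle_cont_def continuous_on_iff, rule_format, OF z0 half_gt_zero[OF \<open>e > 0\<close>]] by auto
    obtain N where N: "1 / real (Suc N) < d"
      using nat_approx_posE[OF d(1)] by blast
    have "norm (fun_calc v h (\<xi> t) - h z0 *\<^sub>C \<xi> t) \<le> e / 2" if t: "t \<ge> N" for t
    proof -
      have hk: "circle_cont (\<lambda>z. (h z - h z0) * k t z)" "circle_cont (\<lambda>z. h z - h z0)"
        using h k by auto
      have ek: "circle_cont (\<lambda>z. of_real (e / 2) * k t z)"
        using k by (intro circle_cont_intros)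
      \<comment> \<open>On the support of the tent h is within e/2 of h z0. The comparison
        \<open>circle_star_hom_norm_le\<close> holds vector by vector, so it survives the
        normalisation of \<xi>.\<close>
      have "cmod ((h z - h z0) * k t z) \<le> cmod (of_real (e / 2) * k t z)" if z: "z \<in> sphere 0 1" for z
      proof (cases "k t z = 0")
        case False
        then have "real (Suc t) * cmod (z - z0) < 1"
          by (auto simp: k_def max_def split: if_splits)
        then have "cmod (z - z0) < 1 / real (Suc t)"
          by (simp add: field_simps)
        also have "\<dots> \<le> 1 / real (Suc N)"
          using t by (intro divide_left_mono) auto
        also note N
        finally have "cmod (h z - h z0) < e / 2"
          using d(2)[OF z] by (simp add: dist_norm)
        then show ?thesis
          using \<open>e > 0\<close> by (simp only: norm_mult norm_of_real) (intro mult_right_mono, auto)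
      qed simp
      then have "norm (fun_calc v (\<lambda>z. (h z - h z0) * k t z) (\<eta> t)) \<le>
          norm (fun_calc v (\<lambda>z. of_real (e / 2) * k t z) (\<eta> t))"
        by (rule circle_star_hom_norm_le[OF hom hk(1) ek])
      also have "fun_calc v (\<lambda>z. of_real (e / 2) * k t z) = scalar_op (of_real (e / 2)) o\<^sub>L fun_calc v (k t)"
        using circle_star_homD(4)[OF hom circle_cont_intros(1) k[of t], of "of_real (e / 2)"]
        by (simp only: circle_star_homD(5)[OF hom])
      also have "norm ((scalar_op (of_real (e / 2)) o\<^sub>L fun_calc v (k t)) (\<eta> t)) = e / 2 * norm (fun_calc v (k t) (\<eta> t))"
        using \<open>e > 0\<close> by (simp add: scalar_op_apply norm_scaleC norm_divide)
      finally have le: "norm (fun_calc v (\<lambda>z. (h z - h z0) * k t z) (\<eta> t)) \<le> \<dots>" .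
      have "fun_calc v h (\<xi> t) - h z0 *\<^sub>C \<xi> t = (fun_calc v (\<lambda>z. h z - h z0)) (\<xi> t)"
        using circle_star_hom_diff[OF hom h, of "\<lambda>z. h z0"]
        by (simp add: circle_star_homD(5)[OF hom] blinfun.diff_left scalar_op_apply)
      also have "\<dots> = r t *\<^sub>R fun_calc v (\<lambda>z. (h z - h z0) * k t z) (\<eta> t)"
        using circle_star_homD(4)[OF hom hk(2) k, of t] by (simp add: \<xi>_def blinfun.scaleR_right)
      finally have "norm (fun_calc v h (\<xi> t) - h z0 *\<^sub>C \<xi> t) =
          r t * norm (fun_calc v (\<lambda>z. (h z - h z0) * k t z) (\<eta> t))"
        by (simp add: r_def)
      also have "\<dots> \<le> r t * (e / 2 * norm (fun_calc v (k t) (\<eta> t)))"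
        by (intro mult_left_mono le) (simp add: r_def)
      also have "\<dots> = e / 2"
        using \<eta>[of t] by (simp add: r_def)
      finally show ?thesis .
    qed
    then show "\<exists>N. \<forall>t\<ge>N. norm (fun_calc v h (\<xi> t) - h z0 *\<^sub>C \<xi> t - 0) < e"
      using \<open>e > 0\<close> by (intro exI[of _ N] allI impI) (rule le_less_trans[of _ "e / 2"], simp_all)
  qed
  moreover have "norm (\<xi> t) = 1" for t
    using \<eta>[of t] by (simp add: \<xi>_def r_def)
  ultimately show ?thesis by blast
qed

section \<open>Zeros on an orbit give an ideal\<close>

lemma u_power_diff_scaleC:
  "(blinfun_apply u ^^ n) (x - c *\<^sub>C y) = (blinfun_apply u ^^ n) x - c *\<^sub>C (blinfun_apply u ^^ n) y"
  by (induction n) (simp_all add: blinfun.diff_right bounded_ops_scaleC u_simps)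

text \<open>The approximate eigenvectors \<open>u ^ j \<xi>\<^sub>t\<close> with \<open>1 \<le> j \<le> n\<close> span an approximately invariant
  subspace, because \<open>f\<close> vanishes at both ends of the orbit segment.  The operators that annihilate
  it asymptotically form a left ideal; its part inside the algebra is a proper two-sided ideal.\<close>

lemma simple_imp_no_two_zeros_on_orbit:
  assumes simple: "simple_cstar (cstar_generated {u o\<^sub>L fun_calc v f, v})"
    and f: "circle_cont f" and f_real: "\<And>z. cnj (f z) = f z"
    and z0: "z0 \<in> sphere 0 1" and n: "n > 0" and "f z0 = 0" and "f (q ^ n * z0) = 0"
  shows False
proof -
  define x where "x = u o\<^sub>L fun_calc v f"
  define A where "A = cstar_generated {x, v}"
  have fc: "fun_calc v h \<in> bounded_ops" if "circle_cont h" for h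
    using that by (rule circle_star_homD(1)[OF hom])
  have x: "x \<in> bounded_ops"
    unfolding x_def by (intro compose_in_bounded_ops u_simps fc f)
  have A: "cstar_subalgebra A"
    unfolding A_def by (rule cstar_subalgebra_generated) (simp add: x v_simps)
  have gen: "x \<in> A" "v \<in> A"
    by (auto simp: A_def intro: cstar_generated_inc)
  have id_A: "id_blinfun \<in> A"
    using cstar_subalgebraD(6)[OF A cstar_subalgebraD(7)[OF A gen(2)] gen(2)] by (simp add: v_simps)
  obtain \<xi> :: "nat \<Rightarrow> 'a" where \<xi>: "\<And>t. norm (\<xi> t) = 1"
    "\<And>h. circle_cont h \<Longrightarrow> (\<lambda>t. fun_calc v h (\<xi> t) - h z0 *\<^sub>C \<xi> t) \<longlonglongrightarrow> 0"
    using approximate_eigenvectors[OF z0] by blast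
  \<comment> \<open>Each application of \<open>u\<close> multiplies the approximate eigenvalue by q,
    so \<open>y j\<close> belongs to the point q^j z0.\<close>
  define y where "y j t = (blinfun_apply u ^^ j) (\<xi> t)" for j t
  have norm_y: "norm (y j t) = 1" for j t
    by (simp add: y_def norm_u_power \<xi>)
  have eig: "(\<lambda>t. fun_calc v h (y j t) - h (q ^ j * z0) *\<^sub>C y j t) \<longlonglongrightarrow> 0" if h: "circle_cont h" for h j
  proof -
    have "circle_cont (\<lambda>z. h (q ^ j * z))"
      by (intro circle_cont_rotate h) (simp add: norm_power norm_q)
    note lim = tendsto_norm_zero[OF \<xi>(2)[OF this]]
    have "norm (fun_calc v h (y j t) - h (q ^ j * z0) *\<^sub>C y j t) =
        norm (fun_calc v (\<lambda>z. h (q ^ j * z)) (\<xi> t) - h (q ^ j * z0) *\<^sub>C \<xi> t)" for t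
      by (simp add: y_def fun_calc_u_power[OF h] norm_u_power flip: u_power_diff_scaleC)
    then show ?thesis
      using lim by (subst tendsto_norm_zero_iff[symmetric]) (simp only:)
  qed
  \<comment> \<open>Asymptotically h(v) acts on \<open>y j\<close> as the scalar h(q^j z0). The
    disjunction is where the two zeros enter: a vanishing scalar replaces knowledge about
    \<open>a\<close>.\<close>
  have push: "(\<lambda>t. a (fun_calc v h (y j t))) \<longlonglongrightarrow> 0"
    if a: "a \<in> bounded_ops" and h: "circle_cont h"
      and "h (q ^ j * z0) = 0 \<or> (\<lambda>t. a (y j t)) \<longlonglongrightarrow> 0" for a h j
  proof -
    have "(\<lambda>t. h (q ^ j * z0) *\<^sub>C a (y j t)) \<longlonglongrightarrow> 0"
      using that(3)
    proof
      assume "h (q ^ j * z0) = 0"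
      then have "h (q ^ j * z0) *\<^sub>C a (y j t) = 0" for t
        by (metis blinfun.zero_left scalar_op_0 scalar_op_apply)
      then show ?thesis by simp
    next
      assume "(\<lambda>t. a (y j t)) \<longlonglongrightarrow> 0"
      from bounded_linear.tendsto_zero[OF bounded_linear_scaleC this] show ?thesis .
    qed
    moreover have "(\<lambda>t. a (fun_calc v h (y j t) - h (q ^ j * z0) *\<^sub>C y j t)) \<longlonglongrightarrow> 0"
      by (rule bounded_linear.tendsto_zero[OF blinfun.bounded_linear_right eig[OF h]])
    ultimately have "(\<lambda>t. a (fun_calc v h (y j t) - h (q ^ j * z0) *\<^sub>C y j t) +
        h (q ^ j * z0) *\<^sub>C a (y j t)) \<longlonglongrightarrow> 0"
      using tendsto_add_zero by blast
    then show ?thesis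
      by (simp add: blinfun.diff_right bounded_ops_scaleC[OF a])
  qed
  define J where "J = {a \<in> bounded_ops. \<forall>j\<in>{1..n}. (\<lambda>t. blinfun_apply a (y j t)) \<longlonglongrightarrow> 0}"
  have J_zero: "0 \<in> J"
    by (simp add: J_def zero_in_bounded_ops)
  have J_add: "a + b \<in> J" if "a \<in> J" "b \<in> J" for a b
    using that by (auto simp: J_def blinfun.add_left intro!: add_in_bounded_ops tendsto_add_zero)
  have J_left: "b o\<^sub>L a \<in> J" if "a \<in> J" "b \<in> bounded_ops" for a b
  proof -
    have "(\<lambda>t. b (a (y j t))) \<longlonglongrightarrow> 0" if "j \<in> {1..n}" for j
      by (rule bounded_linear.tendsto_zero[OF blinfun.bounded_linear_right])
        (use \<open>a \<in> J\<close> that in \<open>simp add: J_def\<close>)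
    then show ?thesis
      using that by (simp add: J_def compose_in_bounded_ops)
  qed
  have "closed J"
    unfolding closed_sequential_limits
  proof (intro allI impI, elim conjE)
    fix a l assume aJ: "\<forall>i. a i \<in> J" and lim: "a \<longlonglongrightarrow> l"
    have "l \<in> bounded_ops"
      using aJ lim closed_bounded_ops closed_sequentially by (metis (mono_tags, lifting) J_def mem_Collect_eq)
    moreover have "(\<lambda>t. l (y j t)) \<longlonglongrightarrow> 0" if j: "j \<in> {1..n}" for j
    proof (rule LIMSEQ_I)
      fix e :: real assume "e > 0"
      obtain i where i: "norm (a i - l) < e / 2"
        using LIMSEQ_D[OF lim half_gt_zero[OF \<open>e > 0\<close>]] by blast
      have "(\<lambda>t. a i (y j t)) \<longlonglongrightarrow> 0"
        using aJ j by (simp add: J_def)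
      then obtain N where N: "\<And>t. t \<ge> N \<Longrightarrow> norm (a i (y j t)) < e / 2"
        using LIMSEQ_D[OF _ half_gt_zero[OF \<open>e > 0\<close>]] by fastforce
      have "norm (l (y j t)) < e" if "t \<ge> N" for t
      proof -
        have "norm (l (y j t)) \<le> norm (a i (y j t)) + norm ((a i - l) (y j t))"
          using norm_triangle_ineq4[of "a i (y j t)" "(a i - l) (y j t)"] by (simp add: blinfun.diff_left)
        also have "norm ((a i - l) (y j t)) \<le> norm (a i - l)"
          using norm_blinfun[of "a i - l" "y j t"] by (simp add: norm_y)
        finally show ?thesis
          using N[OF that] i by linarith
      qed
      then show "\<exists>N. \<forall>t\<ge>N. norm (l (y j t) - 0) < e"
        by auto
    qed
    ultimately show "l \<in> J"
      by (simp add: J_def)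
  qed
  have J_fc: "a o\<^sub>L fun_calc v h \<in> J" if a: "a \<in> J" and h: "circle_cont h" for a h
    using a h by (auto simp: J_def intro!: compose_in_bounded_ops push fc)
  \<comment> \<open>\<open>x\<close> moves \<open>y j\<close> to a multiple of
    \<open>y (Suc j)\<close>; the step out of the segment at \<open>j = n\<close> carries the factor
    f(q^n z0) = 0.\<close>
  have J_x: "a o\<^sub>L x \<in> J" if a: "a \<in> J" for a
  proof -
    have "(\<lambda>t. (a o\<^sub>L u) (fun_calc v f (y j t))) \<longlonglongrightarrow> 0" if j: "j \<in> {1..n}" for j
    proof (rule push[OF _ f])
      show "a o\<^sub>L u \<in> bounded_ops"
        using a by (simp add: J_def compose_in_bounded_ops u_simps)
      have "(\<lambda>t. a (y (Suc j) t)) \<longlonglongrightarrow> 0" if "j \<noteq> n"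
        using a j that by (simp add: J_def)
      then show "f (q ^ j * z0) = 0 \<or> (\<lambda>t. (a o\<^sub>L u) (y j t)) \<longlonglongrightarrow> 0"
        using assms(7) by (cases "j = n") (simp_all add: y_def)
    qed
    then show ?thesis
      using a x by (simp add: J_def x_def compose_in_bounded_ops)
  qed
  have adj_x: "adj x = fun_calc v f o\<^sub>L adj u"
  proof -
    have "adj (fun_calc v f) = fun_calc v f"
      using circle_star_homD(6)[OF hom f] unfolding f_real by (rule sym)
    then show ?thesis
      by (simp add: x_def adj_compose u_simps fc f)
  qed
  \<comment> \<open>\<open>adj x\<close> moves \<open>y j\<close> one index down; the step from 1 to
    0 carries the factor f(z0) = 0.\<close>
  have J_adj_x: "a o\<^sub>L adj x \<in> J" if a: "a \<in> J" for a
  proof -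
    have "(\<lambda>t. a (fun_calc v f (adj u (y j t)))) \<longlonglongrightarrow> 0" if j: "j \<in> {1..n}" for j
    proof -
      obtain i where i: "j = Suc i"
        using j by (cases j) auto
      have "adj u (y j t) = y i t" for t
        by (simp add: i y_def u_simps)
      moreover have "(\<lambda>t. a (fun_calc v f (y i t))) \<longlonglongrightarrow> 0"
      proof (rule push[OF _ f])
        show "a \<in> bounded_ops"
          using a by (simp add: J_def)
        show "f (q ^ i * z0) = 0 \<or> (\<lambda>t. a (y i t)) \<longlonglongrightarrow> 0"
          using a j i assms(6) by (cases "i = 0") (simp_all add: J_def)
      qed
      ultimately show ?thesis by simp
    qed
    then show ?thesis
      using a x by (simp add: J_def adj_x compose_in_bounded_ops u_simps fc f)
  qed
  \<comment> \<open>The self-adjoint part of the right idealiser of \<open>J\<close>. It is a closed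
    star algebra, so checking the two generators shows that all of \<open>A\<close> multiplies
    \<open>J\<close> into itself from the right.\<close>
  define M where "M = {b \<in> bounded_ops. \<forall>a\<in>J. a o\<^sub>L b \<in> J \<and> a o\<^sub>L adj b \<in> J}"
  have J_bo: "a \<in> bounded_ops" if "a \<in> J" for a
    using that by (simp add: J_def)
  have J_scalar: "scalar_op c o\<^sub>L a \<in> J" if "a \<in> J" for a c
    using that J_left scalar_op_in_bounded_ops by blast
  have M: "cstar_subalgebra M"
    unfolding cstar_subalgebra_def star_subalgebra_def
  proof (intro conjI ballI allI)
    show "M \<subseteq> bounded_ops" by (auto simp: M_def)
    have "adj 0 = (0 :: 'a \<Rightarrow>\<^sub>L 'a)"
      using adj_scalar_op[of 0] by (simp add: scalar_op_0)
    then show "0 \<in> M"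
      by (simp add: M_def zero_in_bounded_ops J_zero)
    fix b assume b: "b \<in> M"
    then have b': "b \<in> bounded_ops" by (simp add: M_def)
    show "adj b \<in> M"
      using b by (auto simp: M_def adj_in_bounded_ops adj_adj)
    show "scalar_op c o\<^sub>L b \<in> M" for c
    proof -
      have "adj (scalar_op c o\<^sub>L b) = scalar_op (cnj c) o\<^sub>L adj b"
        using b' by (simp add: adj_compose scalar_op_in_bounded_ops adj_scalar_op adj_in_bounded_ops
            scalar_op_commute)
      then show ?thesis
        using b by (simp add: M_def compose_in_bounded_ops scalar_op_in_bounded_ops
            compose_scalar_op_left J_bo J_scalar)
    qed
    fix c assume c: "c \<in> M"
    then have c': "c \<in> bounded_ops" by (simp add: M_def)
    show "b + c \<in> M"
      using b c by (simp add: M_def add_in_bounded_ops adj_add compose_add_right J_add)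
    have assoc: "a o\<^sub>L (d o\<^sub>L e) = (a o\<^sub>L d) o\<^sub>L e" for a d e :: "'a \<Rightarrow>\<^sub>L 'a"
      by (rule blinfun_eqI) simp
    show "b o\<^sub>L c \<in> M"
      using b c by (simp add: M_def compose_in_bounded_ops adj_compose assoc)
  next
    show "closed M"
      unfolding closed_sequential_limits
    proof (intro allI impI, elim conjE)
      fix b l assume bM: "\<forall>i. b i \<in> M" and lim: "b \<longlonglongrightarrow> l"
      have bo: "b i \<in> bounded_ops" for i
        using bM by (simp add: M_def)
      have l: "l \<in> bounded_ops"
        using bo lim closed_bounded_ops closed_sequentially by blast
      note compose_lim = bounded_bilinear.tendsto[OF bounded_bilinear_blinfun_compose tendsto_const]
      have "a o\<^sub>L l \<in> J" if a: "a \<in> J" for a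
        by (rule closed_sequentially[OF \<open>closed J\<close> _ compose_lim[OF lim]]) (use bM a in \<open>simp add: M_def\<close>)
      moreover have "a o\<^sub>L adj l \<in> J" if a: "a \<in> J" for a
        by (rule closed_sequentially[OF \<open>closed J\<close> _ compose_lim[OF tendsto_adj[OF bo lim]]])
          (use bM a in \<open>simp add: M_def\<close>)
      ultimately show "l \<in> M"
        using l by (simp add: M_def)
    qed
  qed
  have "v \<in> M"
    using J_fc[of _ "\<lambda>z. z"] J_fc[of _ "\<lambda>z. cnj z"] circle_star_homD(6)[OF hom, of "\<lambda>z. z"]
    by (simp add: M_def v_simps fun_calc_circle_star_hom(2)[OF unitary_v])
  moreover have "x \<in> M"
    by (simp add: M_def x J_x J_adj_x)
  ultimately have "A \<subseteq> M"
    unfolding A_def by (intro cstar_generated_least M) simp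
  have "closed_ideal (J \<inter> A) A"
    unfolding closed_ideal_def
  proof (intro conjI ballI allI)
    show "closed (J \<inter> A)"
      by (intro closed_Int \<open>closed J\<close> cstar_subalgebraD(3)[OF A])
    fix a b assume "a \<in> J \<inter> A" "b \<in> A"
    then show "a o\<^sub>L b \<in> J \<inter> A" "b o\<^sub>L a \<in> J \<inter> A"
      using \<open>A \<subseteq> M\<close> J_left cstar_subalgebraD(1,6)[OF A] by (auto simp: M_def)
  qed (auto simp: J_zero J_add J_scalar cstar_subalgebraD(2,4,5)[OF A])
  then have "J \<inter> A = {0} \<or> J \<inter> A = A"
    using simple unfolding simple_cstar_def A_def x_def by blast
  then show False
  proof
    assume "J \<inter> A = A"
    \<comment> \<open>The ideal is proper: otherwise the unit vectors \<open>y 1 t\<close> would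
      tend to 0, the index 1 being available because n > 0.\<close>
    then have "id_blinfun \<in> J"
      using id_A by blast
    then have "(\<lambda>t. y 1 t) \<longlonglongrightarrow> 0"
      using n by (simp add: J_def)
    then have "(\<lambda>t. norm (y 1 t)) \<longlonglongrightarrow> 0"
      by (rule tendsto_norm_zero)
    then show False
      by (simp add: norm_y LIMSEQ_const_iff)
  next
    assume zero: "J \<inter> A = {0}"
    \<comment> \<open>The ideal is not zero: k vanishes on the segment, so k(v) lies in it, while k
      z0 = 0 would make z0 a periodic point of the rotation.\<close>
    define k where "k z = (\<Prod>j\<in>{1..n}. z - q ^ j * z0)" for z
    have k: "circle_cont k"
      unfolding k_def circle_cont_def by (intro continuous_intros)
    have "fun_calc v k \<in> J"
    proof -
      have "(\<lambda>t. id_blinfun (fun_calc v k (y j t))) \<longlonglongrightarrow> 0" if "j \<in> {1..n}" for j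
        by (rule push[OF id_in_bounded_ops k]) (use that in \<open>auto simp: k_def\<close>)
      then show ?thesis
        by (simp add: J_def fc k)
    qed
    moreover have "fun_calc v k \<in> A"
      by (rule circle_star_hom_in_cstar_subalgebra[OF hom k A _ id_A])
        (simp add: fun_calc_circle_star_hom(2)[OF unitary_v] gen)
    ultimately have "fun_calc v k = 0"
      using zero by blast
    then have "k z0 = 0"
      by (rule fun_calc_eq_0D[OF k _ z0])
    then obtain j where "j \<in> {1..n}" "z0 = q ^ j * z0"
      by (auto simp: k_def)
    then show False
      using q_power_neq_1[of j] z0 by auto
  qed
qed

section \<open>Recovering \<open>v\<close>\<close>

text \<open>If the functions \<open>k\<close> with \<open>k(v)\<close> in the algebra do not separate \<open>z\<close> and \<open>w\<close>, conjugating with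
  \<open>u f(v)\<close> shows the same for \<open>q z\<close> and \<open>q w\<close> unless \<open>g z = 0\<close>, and backwards for \<open>z / q\<close> and
  \<open>w / q\<close> unless \<open>g (z / q) = 0\<close>.  In one of the two directions no zero occurs, so \<open>g\<close> is
  invariant under the rotation taking \<open>z\<close> to \<open>w\<close>, which moves the point \<open>p\<close>.\<close>

lemma v_in_cstar_subalgebra:
  fixes g :: "complex \<Rightarrow> real"
  assumes g: "continuous_on (sphere 0 1) g" and g_nonneg: "\<And>z. z \<in> sphere 0 1 \<Longrightarrow> 0 \<le> g z"
    and no_zeros: "\<And>z n. z \<in> sphere 0 1 \<Longrightarrow> n > 0 \<Longrightarrow> g z = 0 \<Longrightarrow> g (q ^ n * z) \<noteq> 0"
    and p: "p \<in> sphere 0 1" and p_unique: "\<And>z. z \<in> sphere 0 1 \<Longrightarrow> g z = g p \<Longrightarrow> z = p"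
    and B: "cstar_subalgebra B" and id_B: "id_blinfun \<in> B"
    and x_B: "u o\<^sub>L fun_calc v (\<lambda>z. of_real (sqrt (g z))) \<in> B"
  shows "v \<in> B"
proof -
  define f where "f z = complex_of_real (sqrt (g z))" for z
  have f: "circle_cont f"
    unfolding f_def by (intro circle_cont_of_real continuous_on_real_sqrt g)
  have f_real: "cnj (f z) = f z" for z
    by (simp add: f_def)
  have ff: "f z * f z = of_real (g z)" if "z \<in> sphere 0 1" for z
    using g_nonneg[OF that] by (simp add: f_def flip: of_real_mult)
  define x where "x = u o\<^sub>L fun_calc v f"
  have fc: "fun_calc v k \<in> bounded_ops" if "circle_cont k" for k
    using that by (rule circle_star_homD(1)[OF hom])
  have adj_x: "adj x = fun_calc v f o\<^sub>L adj u"
  proof -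
    have "adj (fun_calc v f) = fun_calc v f"
      using circle_star_homD(6)[OF hom f] unfolding f_real by (rule sym)
    then show ?thesis
      by (simp add: x_def adj_compose u_simps fc f)
  qed
  have x: "x \<in> B" "adj x \<in> B"
    using x_B cstar_subalgebraD(7)[OF B] by (simp_all add: x_def f_def[abs_def])
  \<comment> \<open>The functions of \<open>v\<close> already available in \<open>B\<close>: a
    conjugation-closed function algebra, to which Stone-Weierstrass will be applied.\<close>
  define D where "D k \<longleftrightarrow> circle_cont k \<and> fun_calc v k \<in> B" for k
  have D_const: "D (\<lambda>z. c)" for c
    using cstar_subalgebraD(5)[OF B id_B, of c] by (simp add: D_def circle_star_homD(5)[OF hom])
  have D_add: "D (\<lambda>z. k z + l z)" if "D k" "D l" for k l
    using that cstar_subalgebraD(4)[OF B] by (simp add: D_def circle_star_homD(3)[OF hom])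
  have D_mult: "D (\<lambda>z. k z * l z)" if "D k" "D l" for k l
    using that cstar_subalgebraD(6)[OF B] by (simp add: D_def circle_star_homD(4)[OF hom])
  have D_cnj: "D (\<lambda>z. cnj (k z))" if "D k" for k
    using that cstar_subalgebraD(7)[OF B] by (simp add: D_def circle_star_homD(6)[OF hom])
  have D_cong: "D l" if "D k" "circle_cont l" "\<And>z. z \<in> sphere 0 1 \<Longrightarrow> k z = l z" for k l
    using that circle_star_homD(2)[OF hom, of k l] by (simp add: D_def)
  note rot = circle_cont_rotate[OF norm_q(1)] circle_cont_rotate[OF norm_q(2)]
  have gc: "circle_cont (\<lambda>z. of_real (g z))"
    by (rule circle_cont_of_real[OF g])
  \<comment> \<open>Compute \<open>adj x k(v) x\<close>: the two copies of f combine to g and the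
    conjugation by \<open>u\<close> rotates k.\<close>
  have D_forward: "D (\<lambda>z. of_real (g z) * k (q * z))" if k: "D k" for k
  proof -
    have kc: "circle_cont k" "fun_calc v k \<in> B"
      using k by (simp_all add: D_def)
    have "fun_calc v (\<lambda>z. f z * (k (q * z) * f z)) = adj x o\<^sub>L (fun_calc v k o\<^sub>L x)"
      unfolding adj_x using f rot(1)[OF kc(1)]
      by (intro blinfun_eqI)
        (simp add: x_def circle_star_homD(4)[OF hom] fun_calc_u[OF kc(1)] u_simps)
    also have "\<dots> \<in> B"
      by (intro cstar_subalgebraD(6)[OF B] x kc)
    finally have "D (\<lambda>z. f z * (k (q * z) * f z))"
      using f rot(1)[OF kc(1)] by (simp add: D_def)
    then show ?thesis
      by (rule D_cong) (use ff rot(1)[OF kc(1)] gc in \<open>auto simp: mult_ac simp flip: ff\<close>)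
  qed
  \<comment> \<open>The opposite product \<open>x k(v) adj x\<close>, in which the conjugation by
    \<open>u\<close> rotates g together with k.\<close>
  have D_backward: "D (\<lambda>z. of_real (g (cnj q * z)) * k (cnj q * z))" if k: "D k" for k
  proof -
    have kc: "circle_cont k" "fun_calc v k \<in> B"
      using k by (simp_all add: D_def)
    have c: "circle_cont (\<lambda>z. f z * (k z * f z))"
      using f kc by auto
    have "fun_calc v (\<lambda>z. f (cnj q * z) * (k (cnj q * z) * f (cnj q * z))) =
        u o\<^sub>L fun_calc v (\<lambda>z. f z * (k z * f z)) o\<^sub>L adj u"
      by (subst fun_calc_conj[OF rot(2)[OF c]]) (simp add: q_cnj flip: mult.assoc)
    also have "\<dots> = x o\<^sub>L (fun_calc v k o\<^sub>L adj x)"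
      unfolding adj_x using f kc
      by (intro blinfun_eqI) (simp add: x_def circle_star_homD(4)[OF hom])
    also have "\<dots> \<in> B"
      by (intro cstar_subalgebraD(6)[OF B] x kc)
    finally have "D (\<lambda>z. f (cnj q * z) * (k (cnj q * z) * f (cnj q * z)))"
      using rot(2)[OF c] by (simp add: D_def)
    then show ?thesis
    proof (rule D_cong)
      show "circle_cont (\<lambda>z. of_real (g (cnj q * z)) * k (cnj q * z))"
        using rot(2)[OF gc] rot(2)[OF kc(1)] by (rule circle_cont_intros)
      fix z :: complex assume "z \<in> sphere 0 1"
      then have "f (cnj q * z) * f (cnj q * z) = of_real (g (cnj q * z))"
        by (intro ff) (simp add: norm_mult norm_q)
      then show "f (cnj q * z) * (k (cnj q * z) * f (cnj q * z)) = of_real (g (cnj q * z)) * k (cnj q * z)"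
        by (metis mult.assoc mult.commute)
    qed
  qed
  have D_g: "D (\<lambda>z. of_real (g z))" "D (\<lambda>z. of_real (g (cnj q * z)))"
    using D_forward[OF D_const[of 1]] D_backward[OF D_const[of 1]] by simp_all
  have sep: "\<exists>k. D k \<and> k z \<noteq> k w" if z: "z \<in> sphere 0 1" and w: "w \<in> sphere 0 1" and "z \<noteq> w" for z w
  proof (rule ccontr)
    define S where "S z w \<longleftrightarrow> (\<forall>k. D k \<longrightarrow> k z = k w)" for z w
    assume "\<nexists>k. D k \<and> k z \<noteq> k w"
    then have S: "S z w" by (simp add: S_def)
    have S_g: "g a = g b" if "S a b" for a b
      using that D_g(1) by (auto simp: S_def)
    have S_forward: "S (q * a) (q * b)" if "S a b" "g a \<noteq> 0" for a b
      unfolding S_def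
    proof (intro allI impI)
      fix k assume "D k"
      then have "of_real (g a) * k (q * a) = of_real (g b) * k (q * b)"
        by (rule \<open>S a b\<close>[unfolded S_def, rule_format, OF D_forward])
      then show "k (q * a) = k (q * b)"
        using S_g[OF that(1)] that(2) by simp
    qed
    have S_backward: "S (cnj q * a) (cnj q * b)" if "S a b" "g (cnj q * a) \<noteq> 0" for a b
      unfolding S_def
    proof (intro allI impI)
      fix k assume "D k"
      then have "of_real (g (cnj q * a)) * k (cnj q * a) = of_real (g (cnj q * b)) * k (cnj q * b)"
        by (rule \<open>S a b\<close>[unfolded S_def, rule_format, OF D_backward])
      moreover have "g (cnj q * a) = g (cnj q * b)"
        using D_g(2) \<open>S a b\<close> unfolding S_def by (metis of_real_eq_iff)
      ultimately show "k (cnj q * a) = k (cnj q * b)"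
        using that(2) by simp
    qed
    \<comment> \<open>If the forward half-orbit of z, including z itself, has no zero, propagate
      forwards. Otherwise that zero is the only one on the orbit, and the backward steps meet
      none.\<close>
    have "(\<forall>n. g (q ^ n * z) - g (q ^ n * w) = 0) \<or> (\<forall>n. g (cnj q ^ n * z) - g (cnj q ^ n * w) = 0)"
    proof (cases "\<exists>n. g (q ^ n * z) = 0")
      case False
      have "S (q ^ n * z) (q ^ n * w)" for n
      proof (induction n)
        case (Suc n)
        then show ?case
          using S_forward[OF Suc] False by (simp add: mult.assoc)
      qed (simp add: S)
      then show ?thesis
        using S_g by simp
    next
      case True
      then obtain n where n: "g (q ^ n * z) = 0" by blast
      have nz: "g (cnj q ^ Suc m * z) \<noteq> 0" for m
      proof
        assume "g (cnj q ^ Suc m * z) = 0"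
        then have "g (q ^ (n + Suc m) * (cnj q ^ Suc m * z)) \<noteq> 0"
          using z by (intro no_zeros) (simp_all add: norm_mult norm_power norm_q)
        moreover have "q ^ (n + Suc m) * (cnj q ^ Suc m * z) = q ^ n * (q * cnj q) ^ Suc m * z"
          unfolding power_add power_mult_distrib by (simp only: mult_ac)
        then have "q ^ (n + Suc m) * (cnj q ^ Suc m * z) = q ^ n * z"
          by (simp only: q_cnj power_one mult_1_right)
        ultimately show False
          using n by (simp only:)
      qed
      have "S (cnj q ^ n * z) (cnj q ^ n * w)" for n
      proof (induction n)
        case (Suc n)
        then show ?case
          using S_backward[OF Suc] nz[of n] by (simp add: mult.assoc)
      qed (simp add: S)
      then show ?thesis
        using S_g by simp
    qed
    moreover have "continuous_on (sphere 0 1) (\<lambda>\<zeta>. g (\<zeta> * a))" if "a \<in> sphere 0 1" for a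
      by (rule continuous_on_compose2[OF g]) (use that in \<open>auto simp: norm_mult intro!: continuous_intros\<close>)
    ultimately have inv: "g (\<zeta> * z) - g (\<zeta> * w) = 0" if "\<zeta> \<in> sphere 0 1" for \<zeta>
      using z w by (intro zero_if_zero_on_orbit[OF _ _ that] continuous_on_diff) blast+
    have zz: "cnj z * z = 1"
      using z complex_norm_square[of z] by (simp add: mult.commute)
    \<comment> \<open>The rotation by p * cnj z takes z to p, so w is taken to a point with the same
      value of g, which must be p.\<close>
    have "g (p * cnj z * w) = g (p * cnj z * z)"
      using inv[of "p * cnj z"] p z by (simp add: norm_mult)
    also have "p * cnj z * z = p"
      by (simp add: mult.assoc zz)
    finally have "p * cnj z * w = p"
      using p z w by (intro p_unique) (simp_all add: norm_mult)
    moreover have "p \<noteq> 0"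
      using p by auto
    ultimately have "cnj z * w = cnj z * z"
      by (simp add: zz mult.assoc)
    moreover have "z \<noteq> 0"
      using z by auto
    ultimately show False
      using \<open>z \<noteq> w\<close> by simp
  qed
  have D_Re: "D (\<lambda>z. of_real (Re (k z)))" if "D k" for k
  proof -
    have re: "(\<lambda>z. complex_of_real (Re (k z))) = (\<lambda>z. (1 / 2) * (k z + cnj (k z)))"
      by (simp add: fun_eq_iff complex_eq_iff)
    show ?thesis
      unfolding re by (rule D_mult[OF D_const D_add[OF that D_cnj[OF that]]])
  qed
  have real_in_B: "fun_calc v (\<lambda>z. of_real (h z)) \<in> B" if h: "continuous_on (sphere 0 1) h" for h
  proof -
    have hc: "circle_cont (\<lambda>z. of_real (h z))"
      by (rule circle_cont_of_real[OF h])
    have "\<exists>T\<in>B. dist T (fun_calc v (\<lambda>z. of_real (h z))) < e" if "e > 0" for e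
    proof -
      define P where "P k \<longleftrightarrow> continuous_on (sphere 0 1) k \<and> D (\<lambda>z. of_real (k z))" for k :: "complex \<Rightarrow> real"
      have P_add: "P (\<lambda>z. k z + l z)" if "P k \<and> P l" for k l
        using that D_add[of "\<lambda>z. of_real (k z)" "\<lambda>z. of_real (l z)"]
        by (simp add: P_def continuous_on_add)
      have P_mult: "P (\<lambda>z. k z * l z)" if "P k \<and> P l" for k l
        using that D_mult[of "\<lambda>z. of_real (k z)" "\<lambda>z. of_real (l z)"]
        by (simp add: P_def continuous_on_mult)
      have P_const: "P (\<lambda>z. c)" for c
        by (simp add: P_def D_const)
      have P_Re: "P (\<lambda>z. Re (k z))" if "D k" for k
        using that D_Re[OF that] by (auto simp: P_def D_def circle_cont_def intro!: continuous_intros)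
      have P_sep: "\<exists>k. P k \<and> k z \<noteq> k w" if zw: "z \<in> sphere 0 1 \<and> w \<in> sphere 0 1 \<and> z \<noteq> w" for z w
      proof -
        obtain k where k: "D k" "k z \<noteq> k w"
          using sep zw by blast
        \<comment> \<open>Multiplication by -\<i> turns the imaginary part into a real part, so
          real-valued functions in D separate points as well.\<close>
        then have "Re (k z) \<noteq> Re (k w) \<or> Re (- \<i> * k z) \<noteq> Re (- \<i> * k w)"
          by (auto simp: complex_eq_iff)
        then show ?thesis
          using P_Re[OF k(1)] P_Re[OF D_mult[OF D_const[of "- \<i>"] k(1)]] by blast
      qed
      obtain k where k: "P k" "\<And>z. z \<in> sphere 0 1 \<Longrightarrow> \<bar>h z - k z\<bar> < e / 2"
        using Stone_Weierstrass_HOL[where P = P, OF compact_sphere P_const _ P_add P_mult P_sep h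
            half_gt_zero[OF \<open>e > 0\<close>]] P_def by blast
      have kc: "circle_cont (\<lambda>z. of_real (k z))" "fun_calc v (\<lambda>z. of_real (k z)) \<in> B"
        using k(1) by (simp_all add: P_def D_def)
      have "norm (fun_calc v (\<lambda>z. complex_of_real (k z) - of_real (h z))) \<le> e / 2"
      proof (rule circle_star_hom_norm_le_const[OF hom circle_cont_intros(5)[OF kc(1) hc]])
        fix z :: complex assume "z \<in> sphere 0 1"
        from k(2)[OF this] show "cmod (complex_of_real (k z) - of_real (h z)) \<le> e / 2"
          unfolding of_real_diff[symmetric] norm_of_real by linarith
      qed (use \<open>e > 0\<close> in simp)
      then have "dist (fun_calc v (\<lambda>z. of_real (k z))) (fun_calc v (\<lambda>z. of_real (h z))) < e"
        using circle_star_hom_diff[OF hom kc(1) hc] \<open>e > 0\<close> by (simp add: dist_norm)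
      then show ?thesis
        using kc(2) by blast
    qed
    then have "fun_calc v (\<lambda>z. of_real (h z)) \<in> closure B"
      by (simp add: closure_approachable)
    then show ?thesis
      using cstar_subalgebraD(3)[OF B] by simp
  qed
  have "D (\<lambda>z. of_real (Re z))" "D (\<lambda>z. of_real (Im z))"
    by (auto simp: D_def intro!: real_in_B circle_cont_of_real continuous_intros)
  from D_add[OF this(1) D_mult[OF D_const[of \<i>] this(2)]] have "D (\<lambda>z. z)"
    by (simp flip: complex_eq)
  then show ?thesis
    by (simp add: D_def fun_calc_circle_star_hom(2)[OF unitary_v])
qed

end

section \<open>The symmetry-breaking generator and the two inclusions\<close>

theorem corollary6p5:
  fixes R :: "('a::complex_hilbert_space \<Rightarrow>\<^sub>L 'a) set"
    and u v :: "'a \<Rightarrow>\<^sub>L 'a"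
    and \<theta> :: real
    and \<gamma> :: "complex \<Rightarrow> real"
  assumes "II1_factor R" and "hyperfinite R"
    and "0 < \<theta>" and "\<theta> < 1" and "\<theta> \<notin> \<rat>"
    and "u \<in> R" and "v \<in> R" and "unitary_op u" and "unitary_op v"
    and "R = commutant (commutant {u, v})"
    and "v o\<^sub>L u = scalar_op (exp (2 * of_real pi * \<i> * of_real \<theta>)) o\<^sub>L (u o\<^sub>L v)"
    and "continuous_on (sphere 0 1) \<gamma>" and "\<forall>z\<in>sphere 0 1. 0 \<le> \<gamma> z"
    and "simple_cstar (gen_rotation_algebra u v \<gamma>)"
  shows "\<exists>f :: complex \<Rightarrow> complex. continuous_on (sphere 0 1) f \<and>
           gen_rotation_algebra u v \<gamma> = cstar_generated {u o\<^sub>L fun_calc v f, id_blinfun}"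
proof -
  define q where "q = cis (2 * pi * \<theta>)"
  have "exp (2 * of_real pi * \<i> * of_real \<theta>) = q"
    by (simp add: q_def cis_conv_exp mult_ac)
  moreover have "(id_blinfun :: 'a \<Rightarrow>\<^sub>L 'a) \<noteq> 0"
    using assms(1) by (simp add: II1_factor_def factor_def)
  ultimately interpret irrational_rotation u v \<theta> q
    using assms by unfold_locales (simp_all add: q_def)
  note \<gamma> = assms(12) assms(13)[rule_format]
  define r where "r z = complex_of_real (sqrt (\<gamma> z))" for z
  have r: "circle_cont r"
    unfolding r_def by (intro circle_cont_of_real continuous_on_real_sqrt \<gamma>)
  define A where "A = cstar_generated {u o\<^sub>L fun_calc v r, v}"
  have A_eq: "gen_rotation_algebra u v \<gamma> = A"
    by (simp add: gen_rotation_algebra_def A_def r_def[abs_def])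
  have no_zeros: "\<gamma> (q ^ n * z) \<noteq> 0" if "z \<in> sphere 0 1" "n > 0" "\<gamma> z = 0" for z n
    using simple_imp_no_two_zeros_on_orbit[OF _ r _ that(1,2)] assms(14) that(3)
    unfolding A_eq A_def by (auto simp: r_def)
  \<comment> \<open>The points 1 and q lie on one orbit, so \<gamma> cannot vanish at both.\<close>
  have "\<exists>p\<in>sphere 0 1. \<gamma> p \<noteq> 0"
    using no_zeros[of 1 1] norm_q by (metis dist_0_norm less_numeral_extra(1) mem_sphere mult.right_neutral norm_one power_one_right)
  then obtain p where p: "p \<in> sphere 0 1" "\<gamma> p > 0"
    using \<gamma>(2) by force
  define d where "d z = \<gamma> z + (cmod (z - p))\<^sup>2" for z
  have d_cont: "continuous_on (sphere 0 1) d"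
    unfolding d_def by (intro continuous_intros \<gamma>)
  have d_pos: "d z > 0" if "z \<in> sphere 0 1" for z
    using \<gamma>(2)[OF that] p(2) by (cases "z = p") (auto simp: d_def add_nonneg_pos)
  define g where "g z = \<gamma> z / d z" for z
  have g_cont: "continuous_on (sphere 0 1) g"
    unfolding g_def using d_pos by (intro continuous_intros \<gamma> d_cont) fastforce
  define f where "f z = complex_of_real (sqrt (g z))" for z
  have f: "circle_cont f"
    unfolding f_def by (intro circle_cont_of_real continuous_on_real_sqrt g_cont)
  define h where "h z = complex_of_real (sqrt (d z))" for z
  have h: "circle_cont h"
    unfolding h_def by (intro circle_cont_of_real continuous_on_real_sqrt d_cont)
  have h': "circle_cont (\<lambda>z. inverse (h z))"
    using h d_pos by (fastforce simp: circle_cont_def h_def intro!: continuous_intros)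
  have "fun_calc v r = fun_calc v (\<lambda>z. f z * h z)"
  proof (rule circle_star_homD(2)[OF hom r])
    fix z :: complex assume "z \<in> sphere 0 1"
    from d_pos[OF this] show "r z = f z * h z"
      unfolding r_def f_def h_def g_def of_real_mult[symmetric] real_sqrt_mult[symmetric] by simp
  qed (use f h in simp)
  \<comment> \<open>The factor h(v) and its inverse lie in every C*-algebra containing
    \<open>v\<close> and 1, so once \<open>v\<close> is in both algebras either generator can be
    rebuilt from the other.\<close>
  then have r_fh: "u o\<^sub>L fun_calc v r = (u o\<^sub>L fun_calc v f) o\<^sub>L fun_calc v h"
    using f h by (intro blinfun_eqI) (simp add: circle_star_homD(4)[OF hom])
  have "fun_calc v f = fun_calc v (\<lambda>z. r z * inverse (h z))"
  proof (rule circle_star_homD(2)[OF hom f])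
    show "f z = r z * inverse (h z)" for z
      by (simp add: r_def f_def h_def g_def real_sqrt_divide divide_inverse real_sqrt_mult real_sqrt_inverse)
  qed (use r h' in simp)
  then have f_rh: "u o\<^sub>L fun_calc v f = (u o\<^sub>L fun_calc v r) o\<^sub>L fun_calc v (\<lambda>z. inverse (h z))"
    using r h' by (intro blinfun_eqI) (simp add: circle_star_homD(4)[OF hom])
  define B where "B = cstar_generated {u o\<^sub>L fun_calc v f, id_blinfun}"
  have bo: "u o\<^sub>L fun_calc v k \<in> bounded_ops" if "circle_cont k" for k
    by (intro compose_in_bounded_ops u_simps circle_star_homD(1)[OF hom] that)
  have A: "cstar_subalgebra A" "u o\<^sub>L fun_calc v r \<in> A" "v \<in> A"
    unfolding A_def
    by (auto intro!: cstar_generated_inc cstar_subalgebra_generated bo r v_simps)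
  have B: "cstar_subalgebra B" "u o\<^sub>L fun_calc v f \<in> B" "id_blinfun \<in> B"
    unfolding B_def
    by (auto intro!: cstar_generated_inc cstar_subalgebra_generated bo f id_in_bounded_ops)
  have id_A: "id_blinfun \<in> A"
    using cstar_subalgebraD(6)[OF A(1) cstar_subalgebraD(7)[OF A(1) A(3)] A(3)] by (simp add: v_simps)
  note calc_in = circle_star_hom_in_cstar_subalgebra[OF hom,
      unfolded fun_calc_circle_star_hom(2)[OF unitary_v]]
  have v_B: "v \<in> B"
  proof (rule v_in_cstar_subalgebra[OF g_cont _ _ p(1) _ B(1,3)])
    show "0 \<le> g z" if "z \<in> sphere 0 1" for z
      using \<gamma>(2)[OF that] d_pos[OF that] by (simp add: g_def)
    show "g (q ^ n * z) \<noteq> 0" if "z \<in> sphere 0 1" "n > 0" "g z = 0" for z n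
      using no_zeros[OF that(1,2)] that d_pos[of z] d_pos[of "q ^ n * z"]
      by (simp add: g_def norm_mult norm_power norm_q)
    \<comment> \<open>At p the quotient is 1, and g z = 1 forces the summand with z - p to
      vanish.\<close>
    show "z = p" if "z \<in> sphere 0 1" "g z = g p" for z
      using that p d_pos[OF that(1)] by (simp add: g_def d_def divide_eq_eq)
    show "u o\<^sub>L fun_calc v (\<lambda>z. of_real (sqrt (g z))) \<in> B"
      using B(2) by (simp add: f_def[abs_def])
  qed
  have "A \<subseteq> B"
    unfolding A_def
  proof (rule cstar_generated_least[OF B(1)])
    show "{u o\<^sub>L fun_calc v r, v} \<subseteq> B"
      unfolding r_fh using v_B by (auto intro!: cstar_subalgebraD(6)[OF B(1)] B calc_in h)
  qed
  moreover have "B \<subseteq> A"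
    unfolding B_def
  proof (rule cstar_generated_least[OF A(1)])
    show "{u o\<^sub>L fun_calc v f, id_blinfun} \<subseteq> A"
      unfolding f_rh using id_A by (auto intro!: cstar_subalgebraD(6)[OF A(1)] A calc_in h')
  qed
  ultimately show ?thesis
    using f A_eq by (auto simp: B_def circle_cont_def)
qed

end
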